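(* Let $(\Sigma,\sigma,\gamma)\colon(\mathcal{B},\chi,T,S)\to(\mathcal{D},\tau,G,C)$ be a $1$-cell in the 2-category $\mathbf{Dist}$ of comonad distributive laws, let $M\colon\mathcal{X}\to\mathcal{B}$ be a functor with $\chi$-coalgebra structure $\rho$, and let $N\colon\mathcal{D}\to\mathcal{Y}$ be a functor with $\tau$-opcoalgebra structure $\lambda$. Then the simplicial morphisms $$N\sigma M\colon \mathrm{C}_G(N,\Sigma M)\to\mathrm{C}_T(N\Sigma,M),\qquad N\gamma M\colon\mathrm{C}^*_S(N\Sigma,M)\to\mathrm{C}^*_C(N,\Sigma M),$$ given in degree $n$ by $N\sigma^{n+1}M$ and $N\gamma^{n+1}M$ respectively, are morphisms of duplicial functors.
   Context: Juxtaposition is horizontal composition, $\circ$ vertical composition; comonad structures are denoted $\delta,\epsilon$. A distributive law of comonads $\chi\colon TS\Rightarrow ST$ on $\mathcal{B}$ satisfies $S\delta\circ\chi=\chi T\circ T\chi\circ\delta S$, $S\epsilon\circ\chi=\epsilon S$, $\delta T\circ\chi=S\chi\circ\chi S\circ T\delta$, $\epsilon T\circ\chi=T\epsilon$. A $1$-cell $(\Sigma,\sigma,\gamma)\colon(\mathcal{B},\chi,T,S)\to(\mathcal{D},\tau,G,C)$ in $\mathbf{Dist}$ is a functor $\Sigma\colon\mathcal{B}\to\mathcal{D}$ with natural transformations $\sigma\colon G\Sigma\Rightarrow\Sigma T$, $\gamma\colon\Sigma S\Rightarrow C\Sigma$ such that $\Sigma\delta\circ\sigma=\sigma T\circ G\sigma\circ\delta\Sigma$,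 $\Sigma\epsilon\circ\sigma=\epsilon\Sigma$, $\delta\Sigma\circ\gamma=C\gamma\circ\gamma S\circ\Sigma\delta$, $\epsilon\Sigma\circ\gamma=\Sigma\epsilon$, and $\gamma T\circ\Sigma\chi\circ\sigma S=C\sigma\circ\tau\Sigma\circ G\gamma$. A $\chi$-coalgebra structure on $M\colon\mathcal{X}\to\mathcal{B}$ is $\rho\colon TM\Rightarrow SM$ with $\delta M\circ\rho=S\rho\circ\chi M\circ T\rho\circ\delta M$ and $\epsilon M\circ\rho=\epsilon M$. A $\chi$-opcoalgebra structure on $N\colon\mathcal{B}\to\mathcal{Y}$ is $\lambda\colon NS\Rightarrow NT$ with $N\delta\circ\lambda=\lambda T\circ N\chi\circ\lambda S\circ N\delta$ and $N\epsilon\circ\lambda=N\epsilon$ (so a $\tau$-opcoalgebra structure on $N\colon\mathcal{D}\to\mathcal{Y}$ is $\lambda\colon NC\Rightarrow NG$). In the situation of the claim, $\Sigma M$ is a $\tau$-coalgebra with structure $\gamma M\circ\Sigma\rho\circ\sigma M$ and $N\Sigma$ is a $\chi$-opcoalgebra with structure $N\sigma\circ\lambda\Sigma\circ N\gamma$. Iterates: $\sigma^0=1$, $\sigma^{n+1}=\sigma T^n\circ G\sigma^n\colon G^{n+1}\Sigma\Rightarrow\Sigma T^{n+1}$; $\gamma^0=1$, $\gamma^{n+1}=C\gamma^n\circ\gamma S^n\colon\Sigma S^{n+1}\Rightarrow C^{n+1}\Sigma$. For a comonad $T$ on $\mathcal{B}$ and functors $M\colon\mathcal{X}\to\mathcal{B}$,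 $N\colon\mathcal{B}\to\mathcal{Y}$, $\mathrm{C}_T(N,M)$ is the simplicial object in $[\mathcal{X},\mathcal{Y}]$ with $\mathrm{C}_T(N,M)_n=NT^{n+1}M$, $d_i=NT^i\epsilon T^{n-i}M$, $s_j=NT^j\delta T^{n-j}M$, and $\mathrm{C}^*_T(N,M)$ has the same objects with $d_i=NT^{n-i}\epsilon T^iM$, $s_j=NT^{n-j}\delta T^jM$. If $M$ is a $\chi$-coalgebra via $\rho$ and $N$ a $\chi$-opcoalgebra via $\lambda$, then $\mathrm{C}_T(N,M)$ and $\mathrm{C}^*_S(N,M)$ are duplicial with operators in degree $n$ $$t_T=\lambda T^nM\circ N\chi^nM\circ NT^n\rho,\qquad t_S=NS^n\rho\circ N\chi^nM\circ\lambda S^nM,$$ where $\chi^n\colon T^nS\Rightarrow ST^n$, respectively $\chi^n\colon TS^n\Rightarrow S^nT$, is the $n$-fold iterate of $\chi$; the same formulas with $\tau,G,C$ apply to $\mathrm{C}_G(N,\Sigma M)$ and $\mathrm{C}^*_C(N,\Sigma M)$. A duplicial functor is a simplicial object $X$ in a functor category with operators $t\colon X_n\to X_n$ such that, on $X_n$, $d_it=td_{i-1}$ for $1\le i\le n$, $d_0t=d_n$, $s_jt=ts_{j-1}$ for $1\le j\le n$, $s_0t=t^2s_n$; morphisms of duplicial functors are simplicial morphisms commuting with the operators $t$. *)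

theory Defs
  imports Main "HOL-Library.FuncSet"
begin

record ('o, 'm) cat =
  Ob :: "'o set"
  Arr :: "'m set"
  Dom :: "'m \<Rightarrow> 'o"
  Cod :: "'m \<Rightarrow> 'o"
  Idn :: "'o \<Rightarrow> 'm"
  Comp :: "'m \<Rightarrow> 'm \<Rightarrow> 'm"

definition arrow :: "('o, 'm, 'z) cat_scheme \<Rightarrow> 'm \<Rightarrow> 'o \<Rightarrow> 'o \<Rightarrow> bool" where
  "arrow A f x y \<longleftrightarrow>
     x \<in> Ob A \<and> y \<in> Ob A \<and> f \<in> Arr A \<and> Dom A f = x \<and> Cod A f = y"

text \<open>\<open>Comp A g f\<close> is \<open>g\<close> after \<open>f\<close>; it is only constrained for composable pairs.\<close>

definition category :: "('o, 'm, 'z) cat_scheme \<Rightarrow> bool" where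
  "category A \<longleftrightarrow>
     (\<forall>f \<in> Arr A. Dom A f \<in> Ob A \<and> Cod A f \<in> Ob A) \<and>
     (\<forall>x \<in> Ob A. arrow A (Idn A x) x x) \<and>
     (\<forall>f g x y z. arrow A f x y \<longrightarrow> arrow A g y z \<longrightarrow> arrow A (Comp A g f) x z) \<and>
     (\<forall>f x y. arrow A f x y \<longrightarrow> Comp A f (Idn A x) = f \<and> Comp A (Idn A y) f = f) \<and>
     (\<forall>f g h w x y z. arrow A f w x \<longrightarrow> arrow A g x y \<longrightarrow> arrow A h y z \<longrightarrow>
        Comp A h (Comp A g f) = Comp A (Comp A h g) f)"

text \<open>Functors and natural transformations carry their source and target, and their underlying
  maps take the value \<^const>\<open>undefined\<close> outside the source category. Hence equality of records
  is equality of functors, respectively of natural transformations.\<close>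

record ('o, 'm, 'p, 'n) ftor =
  FDom :: "('o, 'm) cat"
  FCod :: "('p, 'n) cat"
  FOb :: "'o \<Rightarrow> 'p"
  FArr :: "'m \<Rightarrow> 'n"

definition is_functor ::
    "('o, 'm, 'p, 'n) ftor \<Rightarrow> ('o, 'm) cat \<Rightarrow> ('p, 'n) cat \<Rightarrow> bool" where
  "is_functor F A B \<longleftrightarrow>
     category A \<and> category B \<and> FDom F = A \<and> FCod F = B \<and>
     FOb F \<in> extensional (Ob A) \<and> FArr F \<in> extensional (Arr A) \<and>
     (\<forall>x \<in> Ob A. FOb F x \<in> Ob B) \<and>
     (\<forall>f x y. arrow A f x y \<longrightarrow> arrow B (FArr F f) (FOb F x) (FOb F y)) \<and>
     (\<forall>x \<in> Ob A. FArr F (Idn A x) = Idn B (FOb F x)) \<and>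
     (\<forall>f g x y z. arrow A f x y \<longrightarrow> arrow A g y z \<longrightarrow>
        FArr F (Comp A g f) = Comp B (FArr F g) (FArr F f))"

definition fid :: "('o, 'm) cat \<Rightarrow> ('o, 'm, 'o, 'm) ftor" where
  "fid A = \<lparr> FDom = A, FCod = A, FOb = (\<lambda>x \<in> Ob A. x), FArr = (\<lambda>f \<in> Arr A. f) \<rparr>"

definition fcomp ::
    "('p, 'n, 'q, 'k) ftor \<Rightarrow> ('o, 'm, 'p, 'n) ftor \<Rightarrow> ('o, 'm, 'q, 'k) ftor"
    (infixr \<open>\<cdot>\<close> 75) where
  "F \<cdot> H = \<lparr> FDom = FDom H, FCod = FCod F,
              FOb = (\<lambda>x \<in> Ob (FDom H). FOb F (FOb H x)),
              FArr = (\<lambda>f \<in> Arr (FDom H). FArr F (FArr H f)) \<rparr>"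

primrec fpow :: "('o, 'm, 'o, 'm) ftor \<Rightarrow> nat \<Rightarrow> ('o, 'm, 'o, 'm) ftor" (infixr \<open>\<up>\<close> 80) where
  "T \<up> 0 = fid (FDom T)"
| "T \<up> Suc n = T \<cdot> T \<up> n"

record ('o, 'm, 'p, 'n) ntrans =
  NDom :: "('o, 'm, 'p, 'n) ftor"
  NCod :: "('o, 'm, 'p, 'n) ftor"
  NAt :: "'o \<Rightarrow> 'n"

definition is_nat ::
    "('o, 'm, 'p, 'n) ntrans \<Rightarrow> ('o, 'm, 'p, 'n) ftor \<Rightarrow> ('o, 'm, 'p, 'n) ftor \<Rightarrow> bool" where
  "is_nat \<alpha> F H \<longleftrightarrow>
     is_functor F (FDom F) (FCod F) \<and> is_functor H (FDom F) (FCod F) \<and>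
     NDom \<alpha> = F \<and> NCod \<alpha> = H \<and> NAt \<alpha> \<in> extensional (Ob (FDom F)) \<and>
     (\<forall>x \<in> Ob (FDom F). arrow (FCod F) (NAt \<alpha> x) (FOb F x) (FOb H x)) \<and>
     (\<forall>f x y. arrow (FDom F) f x y \<longrightarrow>
        Comp (FCod F) (NAt \<alpha> y) (FArr F f) = Comp (FCod F) (FArr H f) (NAt \<alpha> x))"

definition nid :: "('o, 'm, 'p, 'n) ftor \<Rightarrow> ('o, 'm, 'p, 'n) ntrans" where
  "nid F = \<lparr> NDom = F, NCod = F, NAt = (\<lambda>x \<in> Ob (FDom F). Idn (FCod F) (FOb F x)) \<rparr>"

definition vcomp ::
    "('o, 'm, 'p, 'n) ntrans \<Rightarrow> ('o, 'm, 'p, 'n) ntrans \<Rightarrow> ('o, 'm, 'p, 'n) ntrans"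
    (infixr \<open>\<odot>\<close> 65) where
  "\<beta> \<odot> \<alpha> = \<lparr> NDom = NDom \<alpha>, NCod = NCod \<beta>,
              NAt = (\<lambda>x \<in> Ob (FDom (NDom \<alpha>)).
                       Comp (FCod (NDom \<alpha>)) (NAt \<beta> x) (NAt \<alpha> x)) \<rparr>"

text \<open>Horizontal composition with a functor: \<open>F \<rhd> \<alpha>\<close> is the transformation \<open>F\<alpha>\<close>, with components
  \<open>F(\<alpha>\<^sub>x)\<close>, and \<open>\<alpha> \<lhd> F\<close> is \<open>\<alpha>F\<close>, with components \<open>\<alpha>\<^sub>F\<^sub>x\<close>.\<close>

definition whisker_left ::
    "('p, 'n, 'q, 'k) ftor \<Rightarrow> ('o, 'm, 'p, 'n) ntrans \<Rightarrow> ('o, 'm, 'q, 'k) ntrans"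
    (infixr \<open>\<rhd>\<close> 70) where
  "F \<rhd> \<alpha> = \<lparr> NDom = F \<cdot> NDom \<alpha>, NCod = F \<cdot> NCod \<alpha>,
              NAt = (\<lambda>x \<in> Ob (FDom (NDom \<alpha>)). FArr F (NAt \<alpha> x)) \<rparr>"

definition whisker_right ::
    "('p, 'n, 'q, 'k) ntrans \<Rightarrow> ('o, 'm, 'p, 'n) ftor \<Rightarrow> ('o, 'm, 'q, 'k) ntrans"
    (infixl \<open>\<lhd>\<close> 72) where
  "\<alpha> \<lhd> F = \<lparr> NDom = NDom \<alpha> \<cdot> F, NCod = NCod \<alpha> \<cdot> F,
              NAt = (\<lambda>x \<in> Ob (FDom F). NAt \<alpha> (FOb F x)) \<rparr>"

definition functor_cat ::
    "('o, 'm) cat \<Rightarrow> ('p, 'n) cat \<Rightarrow> (('o, 'm, 'p, 'n) ftor, ('o, 'm, 'p, 'n) ntrans) cat" where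
  "functor_cat A B = \<lparr> Ob = {F. is_functor F A B},
     Arr = {\<alpha>. is_nat \<alpha> (NDom \<alpha>) (NCod \<alpha>) \<and> is_functor (NDom \<alpha>) A B},
     Dom = NDom, Cod = NCod, Idn = nid, Comp = vcomp \<rparr>"

record ('o, 'm) comonad =
  Fn :: "('o, 'm, 'o, 'm) ftor"
  \<delta> :: "('o, 'm, 'o, 'm) ntrans"
  \<epsilon> :: "('o, 'm, 'o, 'm) ntrans"

definition is_comonad :: "('o, 'm) cat \<Rightarrow> ('o, 'm) comonad \<Rightarrow> bool" where
  "is_comonad B T \<longleftrightarrow>
     is_functor (Fn T) B B \<and>
     is_nat (\<delta> T) (Fn T) (Fn T \<cdot> Fn T) \<and>
     is_nat (\<epsilon> T) (Fn T) (fid B) \<and>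
     (\<delta> T \<lhd> Fn T) \<odot> \<delta> T = (Fn T \<rhd> \<delta> T) \<odot> \<delta> T \<and>
     (\<epsilon> T \<lhd> Fn T) \<odot> \<delta> T = nid (Fn T) \<and>
     (Fn T \<rhd> \<epsilon> T) \<odot> \<delta> T = nid (Fn T)"

definition dist_law ::
    "('o, 'm) cat \<Rightarrow> ('o, 'm, 'o, 'm) ntrans \<Rightarrow> ('o, 'm) comonad \<Rightarrow> ('o, 'm) comonad \<Rightarrow> bool" where
  "dist_law B \<chi> T S \<longleftrightarrow>
     is_comonad B T \<and> is_comonad B S \<and>
     is_nat \<chi> (Fn T \<cdot> Fn S) (Fn S \<cdot> Fn T) \<and>
     (Fn S \<rhd> \<delta> T) \<odot> \<chi> = (\<chi> \<lhd> Fn T) \<odot> (Fn T \<rhd> \<chi>) \<odot> (\<delta> T \<lhd> Fn S) \<and>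
     (Fn S \<rhd> \<epsilon> T) \<odot> \<chi> = \<epsilon> T \<lhd> Fn S \<and>
     (\<delta> S \<lhd> Fn T) \<odot> \<chi> = (Fn S \<rhd> \<chi>) \<odot> (\<chi> \<lhd> Fn S) \<odot> (Fn T \<rhd> \<delta> S) \<and>
     (\<epsilon> S \<lhd> Fn T) \<odot> \<chi> = Fn T \<rhd> \<epsilon> S"

definition dist_1cell ::
    "('o, 'm) cat \<Rightarrow> ('o, 'm, 'o, 'm) ntrans \<Rightarrow> ('o, 'm) comonad \<Rightarrow> ('o, 'm) comonad \<Rightarrow>
     ('p, 'n) cat \<Rightarrow> ('p, 'n, 'p, 'n) ntrans \<Rightarrow> ('p, 'n) comonad \<Rightarrow> ('p, 'n) comonad \<Rightarrow>
     ('o, 'm, 'p, 'n) ftor \<Rightarrow> ('o, 'm, 'p, 'n) ntrans \<Rightarrow> ('o, 'm, 'p, 'n) ntrans \<Rightarrow> bool" where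
  "dist_1cell B \<chi> T S D \<tau> G C \<Sigma> \<sigma> \<gamma> \<longleftrightarrow>
     dist_law B \<chi> T S \<and> dist_law D \<tau> G C \<and>
     is_functor \<Sigma> B D \<and>
     is_nat \<sigma> (Fn G \<cdot> \<Sigma>) (\<Sigma> \<cdot> Fn T) \<and>
     is_nat \<gamma> (\<Sigma> \<cdot> Fn S) (Fn C \<cdot> \<Sigma>) \<and>
     (\<Sigma> \<rhd> \<delta> T) \<odot> \<sigma> = (\<sigma> \<lhd> Fn T) \<odot> (Fn G \<rhd> \<sigma>) \<odot> (\<delta> G \<lhd> \<Sigma>) \<and>
     (\<Sigma> \<rhd> \<epsilon> T) \<odot> \<sigma> = \<epsilon> G \<lhd> \<Sigma> \<and>
     (\<delta> C \<lhd> \<Sigma>) \<odot> \<gamma> = (Fn C \<rhd> \<gamma>) \<odot> (\<gamma> \<lhd> Fn S) \<odot> (\<Sigma> \<rhd> \<delta> S) \<and>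
     (\<epsilon> C \<lhd> \<Sigma>) \<odot> \<gamma> = \<Sigma> \<rhd> \<epsilon> S \<and>
     (\<gamma> \<lhd> Fn T) \<odot> (\<Sigma> \<rhd> \<chi>) \<odot> (\<sigma> \<lhd> Fn S) = (Fn C \<rhd> \<sigma>) \<odot> (\<tau> \<lhd> \<Sigma>) \<odot> (Fn G \<rhd> \<gamma>)"

text \<open>\<open>coalgebra_str \<chi> T S M \<rho>\<close>: \<open>\<rho>\<close> is a \<open>\<chi>\<close>-coalgebra structure on \<open>M\<close>.
  \<open>opcoalgebra_str \<chi> T S N l\<close>: \<open>l\<close> is a \<open>\<chi>\<close>-opcoalgebra structure on \<open>N\<close>.\<close>

definition coalgebra_str ::
    "('o, 'm, 'o, 'm) ntrans \<Rightarrow> ('o, 'm) comonad \<Rightarrow> ('o, 'm) comonad \<Rightarrow>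
     ('p, 'n, 'o, 'm) ftor \<Rightarrow> ('p, 'n, 'o, 'm) ntrans \<Rightarrow> bool" where
  "coalgebra_str \<chi> T S M \<rho> \<longleftrightarrow>
     is_nat \<rho> (Fn T \<cdot> M) (Fn S \<cdot> M) \<and>
     (\<delta> S \<lhd> M) \<odot> \<rho> = (Fn S \<rhd> \<rho>) \<odot> (\<chi> \<lhd> M) \<odot> (Fn T \<rhd> \<rho>) \<odot> (\<delta> T \<lhd> M) \<and>
     (\<epsilon> S \<lhd> M) \<odot> \<rho> = \<epsilon> T \<lhd> M"

definition opcoalgebra_str ::
    "('o, 'm, 'o, 'm) ntrans \<Rightarrow> ('o, 'm) comonad \<Rightarrow> ('o, 'm) comonad \<Rightarrow>
     ('o, 'm, 'p, 'n) ftor \<Rightarrow> ('o, 'm, 'p, 'n) ntrans \<Rightarrow> bool" where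
  "opcoalgebra_str \<chi> T S N l \<longleftrightarrow>
     is_nat l (N \<cdot> Fn S) (N \<cdot> Fn T) \<and>
     (N \<rhd> \<delta> T) \<odot> l = (l \<lhd> Fn T) \<odot> (N \<rhd> \<chi>) \<odot> (l \<lhd> Fn S) \<odot> (N \<rhd> \<delta> S) \<and>
     (N \<rhd> \<epsilon> T) \<odot> l = N \<rhd> \<epsilon> S"

text \<open>The structures induced on \<open>\<Sigma>M\<close> and on \<open>N\<Sigma>\<close> by a 1-cell \<open>(\<Sigma>, \<sigma>, \<gamma>)\<close>.\<close>

definition push_coalgebra ::
    "('o, 'm, 'p, 'n) ftor \<Rightarrow> ('o, 'm, 'p, 'n) ntrans \<Rightarrow> ('o, 'm, 'p, 'n) ntrans \<Rightarrow>
     ('q, 'k, 'o, 'm) ftor \<Rightarrow> ('q, 'k, 'o, 'm) ntrans \<Rightarrow> ('q, 'k, 'p, 'n) ntrans" where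
  "push_coalgebra \<Sigma> \<sigma> \<gamma> M \<rho> = (\<gamma> \<lhd> M) \<odot> (\<Sigma> \<rhd> \<rho>) \<odot> (\<sigma> \<lhd> M)"

definition pull_opcoalgebra ::
    "('o, 'm, 'p, 'n) ftor \<Rightarrow> ('o, 'm, 'p, 'n) ntrans \<Rightarrow> ('o, 'm, 'p, 'n) ntrans \<Rightarrow>
     ('p, 'n, 'q, 'k) ftor \<Rightarrow> ('p, 'n, 'q, 'k) ntrans \<Rightarrow> ('o, 'm, 'q, 'k) ntrans" where
  "pull_opcoalgebra \<Sigma> \<sigma> \<gamma> N l = (N \<rhd> \<sigma>) \<odot> (l \<lhd> \<Sigma>) \<odot> (N \<rhd> \<gamma>)"

text \<open>Iterates \<open>\<sigma>\<^sup>n: G\<^sup>n\<Sigma> \<Rightarrow> \<Sigma>T\<^sup>n\<close> of \<open>\<sigma>: G\<Sigma> \<Rightarrow> \<Sigma>T\<close> and \<open>\<gamma>\<^sup>n: \<Sigma>S\<^sup>n \<Rightarrow> C\<^sup>n\<Sigma>\<close> of \<open>\<gamma>: \<Sigma>S \<Rightarrow> C\<Sigma>\<close>.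
  The two iterates of \<open>\<chi>: TS \<Rightarrow> ST\<close> are the instances \<open>iter_l T S T \<chi> n: T\<^sup>nS \<Rightarrow> ST\<^sup>n\<close> and
  \<open>iter_r S T S \<chi> n: TS\<^sup>n \<Rightarrow> S\<^sup>nT\<close>.\<close>

primrec iter_l ::
    "('p, 'n, 'p, 'n) ftor \<Rightarrow> ('o, 'm, 'p, 'n) ftor \<Rightarrow> ('o, 'm, 'o, 'm) ftor \<Rightarrow>
     ('o, 'm, 'p, 'n) ntrans \<Rightarrow> nat \<Rightarrow> ('o, 'm, 'p, 'n) ntrans" where
  "iter_l G \<Sigma> T \<sigma> 0 = nid \<Sigma>"
| "iter_l G \<Sigma> T \<sigma> (Suc n) = (\<sigma> \<lhd> T \<up> n) \<odot> (G \<rhd> iter_l G \<Sigma> T \<sigma> n)"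

primrec iter_r ::
    "('o, 'm, 'o, 'm) ftor \<Rightarrow> ('o, 'm, 'p, 'n) ftor \<Rightarrow> ('p, 'n, 'p, 'n) ftor \<Rightarrow>
     ('o, 'm, 'p, 'n) ntrans \<Rightarrow> nat \<Rightarrow> ('o, 'm, 'p, 'n) ntrans" where
  "iter_r S \<Sigma> C \<gamma> 0 = nid \<Sigma>"
| "iter_r S \<Sigma> C \<gamma> (Suc n) = (C \<rhd> iter_r S \<Sigma> C \<gamma> n) \<odot> (\<gamma> \<lhd> S \<up> n)"

text \<open>\<open>face X n i\<close> is \<open>d\<^sub>i: X\<^sub>n \<rightarrow> X\<^sub>n\<^sub>-\<^sub>1\<close> (relevant for \<open>1 \<le> n\<close>, \<open>i \<le> n\<close>) and \<open>degen X n j\<close> is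
  \<open>s\<^sub>j: X\<^sub>n \<rightarrow> X\<^sub>n\<^sub>+\<^sub>1\<close> (relevant for \<open>j \<le> n\<close>): the first index is always the degree of the source.\<close>

record ('o, 'm) simp_obj =
  obj :: "nat \<Rightarrow> 'o"
  face :: "nat \<Rightarrow> nat \<Rightarrow> 'm"
  degen :: "nat \<Rightarrow> nat \<Rightarrow> 'm"

record ('o, 'm) dupl_obj = "('o, 'm) simp_obj" +
  tt :: "nat \<Rightarrow> 'm"

definition simplicial ::
    "('o, 'm) cat \<Rightarrow> ('o, 'm, 'z) simp_obj_scheme \<Rightarrow> bool" where
  "simplicial K X \<longleftrightarrow>
     category K \<and>
     (\<forall>n. obj X n \<in> Ob K) \<and>
     (\<forall>n i. i \<le> Suc n \<longrightarrow> arrow K (face X (Suc n) i) (obj X (Suc n)) (obj X n)) \<and>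
     (\<forall>n j. j \<le> n \<longrightarrow> arrow K (degen X n j) (obj X n) (obj X (Suc n))) \<and>
     (\<forall>n i j. i < j \<and> j \<le> n + 2 \<longrightarrow>
        Comp K (face X (n + 1) i) (face X (n + 2) j) =
        Comp K (face X (n + 1) (j - 1)) (face X (n + 2) i)) \<and>
     (\<forall>n i j. i \<le> j \<and> j \<le> n \<longrightarrow>
        Comp K (degen X (n + 1) i) (degen X n j) =
        Comp K (degen X (n + 1) (j + 1)) (degen X n i)) \<and>
     (\<forall>n i j. i < j \<and> j \<le> n \<longrightarrow>
        Comp K (face X (n + 1) i) (degen X n j) =
        Comp K (degen X (n - 1) (j - 1)) (face X n i)) \<and>
     (\<forall>n i j. (i = j \<or> i = j + 1) \<and> j \<le> n \<longrightarrow>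
        Comp K (face X (n + 1) i) (degen X n j) = Idn K (obj X n)) \<and>
     (\<forall>n i j. j + 1 < i \<and> i \<le> n + 1 \<longrightarrow>
        Comp K (face X (n + 1) i) (degen X n j) =
        Comp K (degen X (n - 1) j) (face X n (i - 1)))"

text \<open>The identities involving \<open>d\<^sub>i\<close> are required in the degrees \<open>n \<ge> 1\<close> where \<open>d\<^sub>i\<close> exists.\<close>

definition duplicial ::
    "('o, 'm) cat \<Rightarrow> ('o, 'm, 'z) dupl_obj_scheme \<Rightarrow> bool" where
  "duplicial K X \<longleftrightarrow>
     simplicial K X \<and>
     (\<forall>n. arrow K (tt X n) (obj X n) (obj X n)) \<and>
     (\<forall>n i. 1 \<le> i \<and> i \<le> n \<longrightarrow>
        Comp K (face X n i) (tt X n) = Comp K (tt X (n - 1)) (face X n (i - 1))) \<and>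
     (\<forall>n \<ge> 1. Comp K (face X n 0) (tt X n) = face X n n) \<and>
     (\<forall>n j. 1 \<le> j \<and> j \<le> n \<longrightarrow>
        Comp K (degen X n j) (tt X n) = Comp K (tt X (n + 1)) (degen X n (j - 1))) \<and>
     (\<forall>n. Comp K (degen X n 0) (tt X n) =
        Comp K (tt X (n + 1)) (Comp K (tt X (n + 1)) (degen X n n)))"

definition simplicial_morphism ::
    "('o, 'm) cat \<Rightarrow> ('o, 'm, 'y) simp_obj_scheme \<Rightarrow> ('o, 'm, 'z) simp_obj_scheme \<Rightarrow>
     (nat \<Rightarrow> 'm) \<Rightarrow> bool" where
  "simplicial_morphism K X Y f \<longleftrightarrow>
     simplicial K X \<and> simplicial K Y \<and>
     (\<forall>n. arrow K (f n) (obj X n) (obj Y n)) \<and>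
     (\<forall>n i. i \<le> Suc n \<longrightarrow>
        Comp K (face Y (Suc n) i) (f (Suc n)) = Comp K (f n) (face X (Suc n) i)) \<and>
     (\<forall>n j. j \<le> n \<longrightarrow>
        Comp K (degen Y n j) (f n) = Comp K (f (Suc n)) (degen X n j))"

definition duplicial_morphism ::
    "('o, 'm) cat \<Rightarrow> ('o, 'm, 'y) dupl_obj_scheme \<Rightarrow> ('o, 'm, 'z) dupl_obj_scheme \<Rightarrow>
     (nat \<Rightarrow> 'm) \<Rightarrow> bool" where
  "duplicial_morphism K X Y f \<longleftrightarrow>
     duplicial K X \<and> duplicial K Y \<and> simplicial_morphism K X Y f \<and>
     (\<forall>n. Comp K (tt Y n) (f n) = Comp K (f n) (tt X n))"

text \<open>\<open>bar_dup \<chi> T S N l M \<rho>\<close> is \<open>C\<^sub>T(N, M)\<close> and \<open>bar_op_dup \<chi> T S N l M \<rho>\<close> is \<open>C\<^sup>*\<^sub>S(N, M)\<close>, with the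
  operators \<open>t\<^sub>T\<close> and \<open>t\<^sub>S\<close> coming from \<open>\<chi>\<close>, \<open>\<rho>\<close> and \<open>l\<close>.\<close>

definition bar_dup ::
    "('o, 'm, 'o, 'm) ntrans \<Rightarrow> ('o, 'm) comonad \<Rightarrow> ('o, 'm) comonad \<Rightarrow>
     ('o, 'm, 'q, 'k) ftor \<Rightarrow> ('o, 'm, 'q, 'k) ntrans \<Rightarrow>
     ('p, 'n, 'o, 'm) ftor \<Rightarrow> ('p, 'n, 'o, 'm) ntrans \<Rightarrow>
     (('p, 'n, 'q, 'k) ftor, ('p, 'n, 'q, 'k) ntrans) dupl_obj" where
  "bar_dup \<chi> T S N l M \<rho> = \<lparr>
     obj = (\<lambda>n. N \<cdot> Fn T \<up> (n + 1) \<cdot> M),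
     face = (\<lambda>n i. (N \<cdot> Fn T \<up> i) \<rhd> \<epsilon> T \<lhd> (Fn T \<up> (n - i) \<cdot> M)),
     degen = (\<lambda>n j. (N \<cdot> Fn T \<up> j) \<rhd> \<delta> T \<lhd> (Fn T \<up> (n - j) \<cdot> M)),
     tt = (\<lambda>n. (l \<lhd> (Fn T \<up> n \<cdot> M))
              \<odot> (N \<rhd> iter_l (Fn T) (Fn S) (Fn T) \<chi> n \<lhd> M)
              \<odot> ((N \<cdot> Fn T \<up> n) \<rhd> \<rho>)) \<rparr>"

definition bar_op_dup ::
    "('o, 'm, 'o, 'm) ntrans \<Rightarrow> ('o, 'm) comonad \<Rightarrow> ('o, 'm) comonad \<Rightarrow>
     ('o, 'm, 'q, 'k) ftor \<Rightarrow> ('o, 'm, 'q, 'k) ntrans \<Rightarrow>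
     ('p, 'n, 'o, 'm) ftor \<Rightarrow> ('p, 'n, 'o, 'm) ntrans \<Rightarrow>
     (('p, 'n, 'q, 'k) ftor, ('p, 'n, 'q, 'k) ntrans) dupl_obj" where
  "bar_op_dup \<chi> T S N l M \<rho> = \<lparr>
     obj = (\<lambda>n. N \<cdot> Fn S \<up> (n + 1) \<cdot> M),
     face = (\<lambda>n i. (N \<cdot> Fn S \<up> (n - i)) \<rhd> \<epsilon> S \<lhd> (Fn S \<up> i \<cdot> M)),
     degen = (\<lambda>n j. (N \<cdot> Fn S \<up> (n - j)) \<rhd> \<delta> S \<lhd> (Fn S \<up> j \<cdot> M)),
     tt = (\<lambda>n. ((N \<cdot> Fn S \<up> n) \<rhd> \<rho>)
              \<odot> (N \<rhd> iter_r (Fn S) (Fn T) (Fn S) \<chi> n \<lhd> M)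
              \<odot> (l \<lhd> (Fn S \<up> n \<cdot> M))) \<rparr>"

end

theory Submission
  imports Defs
begin

text \<open>An equation between natural transformations may be checked at one object \<open>x\<close> at a time, so everything
takes place in the single category \<open>Y\<close>. There the simplicial part of \<open>C\<^sub>T(N, M)\<close> becomes the image under
\<open>N\<close> of the simplicial object \<open>b, T b, T\<^sup>2 b, \<dots>\<close> of the comonad at \<open>b = M x\<close>, and \<open>C\<^sup>*\<^sub>S(N, M)\<close> is the image
of the same construction for \<open>S\<close> with the order of faces and degeneracies reversed.

The duplicial operators are organised around one arrow. Write \<open>w\<^sub>n: T T\<^sup>nM \<Rightarrow> S T\<^sup>nM\<close> for
\<open>\<chi>\<^sup>nM \<circ> T\<^sup>n\<rho>\<close>; then \<open>t\<^sub>T\<close> is \<open>l T\<^sup>nM \<circ> N w\<^sub>n\<close>. A face or degeneracy of positive index is \<open>T\<close> of the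
one before it; \<open>l\<close> changes this \<open>T\<close> into \<open>S\<close> by naturality, and \<open>w\<close> removes the \<open>S\<close>, so that the index drops by
one. The counit \<open>\<epsilon>\<^sub>S\<close> turns \<open>w\<^sub>n\<close> into the last face, and \<open>\<delta>\<^sub>S\<close> turns it into \<open>S w\<^sub>n \<circ> w\<^sub>n\<^sub>+\<^sub>1 \<circ> s\<^sub>n\<close>. Together with the
opcoalgebra axioms for \<open>l\<close>, which deal with the face and degeneracy of index \<open>0\<close>, these four facts are the
four families of duplicial identities. For \<open>t\<^sub>S\<close> the same role is played by \<open>S\<^sup>n\<rho> \<circ> \<chi>\<^sup>nM: T S\<^sup>nM \<Rightarrow> S S\<^sup>nM\<close>.

A distributive law \<open>\<chi>\<close> makes \<open>S\<close> a morphism of comonads from \<open>T\<close> to \<open>T\<close> and \<open>T\<close> an opmorphism of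
comonads from \<open>S\<close> to \<open>S\<close>, just as \<open>\<sigma>\<close> and \<open>\<gamma>\<close> do for \<open>\<Sigma>\<close>. Hence the same lemmas on iterates,
\<open>iter_face\<close> and \<open>iter_degen\<close>, move faces and degeneracies past \<open>\<chi>\<^sup>n\<close>, for the duplicial identities, and show that
\<open>N\<sigma>M\<close> and \<open>N\<gamma>M\<close> are simplicial.

Compatibility with \<open>t\<close> rests on the axiom of a 1-cell that involves \<open>\<chi>\<close> and \<open>\<tau>\<close>, iterated in
\<open>hexagon_\<sigma>_iter\<close> and \<open>hexagon_\<gamma>_iter\<close>. Combined with naturality it yields \<open>coalg_T_push\<close>, which
says that \<open>\<sigma>\<^sup>n\<close> carries the arrow \<open>w\<^sub>n\<close> for \<open>\<Sigma>M\<close> to \<open>\<gamma> \<circ> \<Sigma>w\<^sub>n \<circ> \<sigma>\<^sup>n\<^sup>+\<^sup>1\<close>. In \<open>N\<sigma>\<^sup>n\<^sup>+\<^sup>1M \<circ> t\<^sub>G\<close> the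
outermost \<open>\<sigma>\<close> stays in front of \<open>l\<close> while \<open>\<sigma>\<^sup>n\<close> passes it and meets \<open>w\<^sub>n\<close>; the \<open>\<gamma>\<close> that this produces forms,
with \<open>l\<close> and that \<open>\<sigma>\<close>, the induced structure \<open>N\<sigma> \<circ> l\<Sigma> \<circ> N\<gamma>\<close> on \<open>N\<Sigma>\<close>. The argument for \<open>\<gamma>\<close> is the mirror image.\<close>

section \<open>Categories and functors\<close>

text \<open>Typing is expressed through \<^const>\<open>Dom\<close> and \<^const>\<open>Cod\<close> rather than through \<^const>\<open>arrow\<close>: then,
for given functors and transformations, no side condition of a rewrite rule contains a variable that the left-hand side does not determine, and
composites are kept nested to the right by \<open>Comp_assoc\<close>.\<close>

lemma arrow_iff:
  "category A \<Longrightarrow> arrow A f x y \<longleftrightarrow> f \<in> Arr A \<and> Dom A f = x \<and> Cod A f = y"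
  unfolding category_def arrow_def by auto

lemma Dom_in_Ob [simp]: "category A \<Longrightarrow> f \<in> Arr A \<Longrightarrow> Dom A f \<in> Ob A"
  and Cod_in_Ob [simp]: "category A \<Longrightarrow> f \<in> Arr A \<Longrightarrow> Cod A f \<in> Ob A"
  unfolding category_def by auto

lemma Idn_arrow:
  assumes "category A" "x \<in> Ob A"
  shows "arrow A (Idn A x) x x"
  using assms unfolding category_def by auto

lemma Idn_simps [simp]:
  assumes "category A" "x \<in> Ob A"
  shows "Idn A x \<in> Arr A" "Dom A (Idn A x) = x" "Cod A (Idn A x) = x"
  using Idn_arrow[OF assms] by (auto simp: arrow_def)

lemma Comp_arrow:
  assumes "category A" "f \<in> Arr A" "g \<in> Arr A" "Cod A f = Dom A g"
  shows "arrow A (Comp A g f) (Dom A f) (Cod A g)"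
proof -
  have "arrow A f (Dom A f) (Cod A f)" "arrow A g (Cod A f) (Cod A g)"
    using assms by (simp_all add: arrow_iff)
  then show ?thesis using assms(1) unfolding category_def by blast
qed

lemma Comp_simps [simp]:
  assumes "category A" "f \<in> Arr A" "g \<in> Arr A" "Cod A f = Dom A g"
  shows "Comp A g f \<in> Arr A" "Dom A (Comp A g f) = Dom A f" "Cod A (Comp A g f) = Cod A g"
  using Comp_arrow[OF assms] by (auto simp: arrow_def)

lemma Comp_Idn [simp]:
  assumes "category A" "f \<in> Arr A"
  shows "Dom A f = x \<Longrightarrow> Comp A f (Idn A x) = f" "Cod A f = x \<Longrightarrow> Comp A (Idn A x) f = f"
proof -
  have "arrow A f (Dom A f) (Cod A f)"
    using assms by (simp add: arrow_iff)
  then have "Comp A f (Idn A (Dom A f)) = f \<and> Comp A (Idn A (Cod A f)) f = f"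
    using assms(1) unfolding category_def by blast
  then show "Dom A f = x \<Longrightarrow> Comp A f (Idn A x) = f" "Cod A f = x \<Longrightarrow> Comp A (Idn A x) f = f"
    by auto
qed

lemma Comp_assoc [simp]:
  assumes "category A" "f \<in> Arr A" "g \<in> Arr A" "h \<in> Arr A"
    and "Cod A f = Dom A g" "Cod A g = Dom A h"
  shows "Comp A (Comp A h g) f = Comp A h (Comp A g f)"
proof -
  have "arrow A f (Dom A f) (Cod A f)" "arrow A g (Cod A f) (Cod A g)"
    "arrow A h (Cod A g) (Cod A h)"
    using assms by (simp_all add: arrow_iff)
  then show ?thesis using assms(1) unfolding category_def by metis
qed

text \<open>In a right-nested composite the left-hand side \<open>h \<circ> g\<close> of an equation is no subterm unless it stands at
the end; these two lemmas extend an equation so that it applies in front of a further arrow \<open>k\<close>.\<close>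

lemma Comp_tail:
  assumes "Comp A h g = m" "category A"
    and "k \<in> Arr A" "g \<in> Arr A" "h \<in> Arr A" "Cod A k = Dom A g" "Cod A g = Dom A h"
  shows "Comp A h (Comp A g k) = Comp A m k"
  using assms by (metis Comp_assoc)

lemma Comp_tail3:
  assumes "Comp A h (Comp A g f) = m" "category A"
    and "k \<in> Arr A" "f \<in> Arr A" "g \<in> Arr A" "h \<in> Arr A"
    and "Cod A k = Dom A f" "Cod A f = Dom A g" "Cod A g = Dom A h"
  shows "Comp A h (Comp A g (Comp A f k)) = Comp A m k"
  using assms by (metis Comp_assoc Comp_simps)

lemma functor_category:
  assumes "is_functor F A B"
  shows "category A" "category B"
  using assms unfolding is_functor_def by auto

lemma functor_FDom: "is_functor F A B \<Longrightarrow> FDom F = A"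
  and functor_FCod: "is_functor F A B \<Longrightarrow> FCod F = B"
  and functor_FOb: "is_functor F A B \<Longrightarrow> x \<in> Ob A \<Longrightarrow> FOb F x \<in> Ob B"
  and functor_Idn: "is_functor F A B \<Longrightarrow> x \<in> Ob A \<Longrightarrow> FArr F (Idn A x) = Idn B (FOb F x)"
  unfolding is_functor_def by auto

lemma functor_arrow:
  assumes "is_functor F A B" "f \<in> Arr A"
  shows "arrow B (FArr F f) (FOb F (Dom A f)) (FOb F (Cod A f))"
proof -
  have "arrow A f (Dom A f) (Cod A f)"
    using assms(2) functor_category[OF assms(1)] by (simp add: arrow_iff)
  then show ?thesis using assms(1) unfolding is_functor_def by blast
qed

lemma functor_FArr: "is_functor F A B \<Longrightarrow> f \<in> Arr A \<Longrightarrow> FArr F f \<in> Arr B"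
  and functor_Dom: "is_functor F A B \<Longrightarrow> f \<in> Arr A \<Longrightarrow> Dom B (FArr F f) = FOb F (Dom A f)"
  and functor_Cod: "is_functor F A B \<Longrightarrow> f \<in> Arr A \<Longrightarrow> Cod B (FArr F f) = FOb F (Cod A f)"
  using functor_arrow[of F A B f] by (auto simp: arrow_def)

lemma functor_Comp:
  assumes "is_functor F A B" "f \<in> Arr A" "g \<in> Arr A" "Cod A f = Dom A g"
  shows "FArr F (Comp A g f) = Comp B (FArr F g) (FArr F f)"
proof -
  have "arrow A f (Dom A f) (Cod A f)" "arrow A g (Cod A f) (Cod A g)"
    using assms functor_category[OF assms(1)] by (simp_all add: arrow_iff)
  then show ?thesis using assms(1) unfolding is_functor_def by blast
qed

lemma functor_Comp_eq:
  assumes "Comp A g f = m" "is_functor F A B" "f \<in> Arr A" "g \<in> Arr A" "Cod A f = Dom A g"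
  shows "Comp B (FArr F g) (FArr F f) = FArr F m"
  using assms functor_Comp by metis

lemmas functor_simps = functor_category functor_FDom functor_FCod functor_FOb functor_FArr
  functor_Dom functor_Cod functor_Idn functor_Comp

lemma is_functorI:
  assumes "category A" "category B" "FDom F = A" "FCod F = B"
    and "FOb F \<in> extensional (Ob A)" "FArr F \<in> extensional (Arr A)"
    and "\<And>x. x \<in> Ob A \<Longrightarrow> FOb F x \<in> Ob B"
    and "\<And>f. f \<in> Arr A \<Longrightarrow> FArr F f \<in> Arr B \<and> Dom B (FArr F f) = FOb F (Dom A f)
           \<and> Cod B (FArr F f) = FOb F (Cod A f)"
    and "\<And>x. x \<in> Ob A \<Longrightarrow> FArr F (Idn A x) = Idn B (FOb F x)"
    and "\<And>f g. f \<in> Arr A \<Longrightarrow> g \<in> Arr A \<Longrightarrow> Cod A f = Dom A g \<Longrightarrow>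
           FArr F (Comp A g f) = Comp B (FArr F g) (FArr F f)"
  shows "is_functor F A B"
  unfolding is_functor_def using assms by (auto simp: arrow_iff)

lemma functor_eqI:
  assumes "is_functor F A B" "is_functor H A B"
    and "\<And>x. x \<in> Ob A \<Longrightarrow> FOb F x = FOb H x"
    and "\<And>f. f \<in> Arr A \<Longrightarrow> FArr F f = FArr H f"
  shows "F = H"
proof -
  have "FOb F = FOb H" "FArr F = FArr H"
    using assms by (auto simp: is_functor_def intro: extensionalityI)
  moreover have "FDom F = FDom H" "FCod F = FCod H"
    using assms by (simp_all add: functor_simps)
  ultimately show ?thesis by simp
qed

lemma fid_simps [simp]:
  "FDom (fid A) = A" "FCod (fid A) = A"
  "x \<in> Ob A \<Longrightarrow> FOb (fid A) x = x" "f \<in> Arr A \<Longrightarrow> FArr (fid A) f = f"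
  by (simp_all add: fid_def)

lemma fid_functor [simp]: "category A \<Longrightarrow> is_functor (fid A) A A"
  by (rule is_functorI) (auto simp: fid_def)

lemma fcomp_simps [simp]:
  "FDom (F \<cdot> H) = FDom H" "FCod (F \<cdot> H) = FCod F"
  "x \<in> Ob (FDom H) \<Longrightarrow> FOb (F \<cdot> H) x = FOb F (FOb H x)"
  "f \<in> Arr (FDom H) \<Longrightarrow> FArr (F \<cdot> H) f = FArr F (FArr H f)"
  by (simp_all add: fcomp_def)

text \<open>The middle category is written as the source of the outer functor, so that every variable of
  a side condition is fixed by the conclusion and the simplifier can discharge it.\<close>

lemma fcomp_functor [simp]:
  assumes "is_functor H A (FDom F)" "is_functor F (FDom F) C"
  shows "is_functor (F \<cdot> H) A C"
  using functor_simps[OF assms(1)] functor_simps[OF assms(2)]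
  by (intro is_functorI) (auto simp: fcomp_def)

lemma fcomp_assoc [simp]:
  assumes "is_functor H (FDom H) (FDom G)"
  shows "(F \<cdot> G) \<cdot> H = F \<cdot> G \<cdot> H"
  using functor_simps[OF assms]
  by (auto simp: fcomp_def intro!: restrict_ext)

lemma fid_fcomp [simp]:
  assumes "is_functor F (FDom F) B"
  shows "fid B \<cdot> F = F"
proof -
  note [simp] = functor_simps(1-2,4-)[OF assms]
  show ?thesis by (rule functor_eqI[of _ "FDom F" B]) (use assms in simp_all)
qed

lemma fcomp_fid [simp]:
  assumes "is_functor F A (FCod F)"
  shows "F \<cdot> fid A = F"
proof -
  note [simp] = functor_simps(1-3,5-)[OF assms]
  show ?thesis by (rule functor_eqI[of _ A "FCod F"]) (use assms in simp_all)
qed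

lemma fpow_functor: "is_functor T B B \<Longrightarrow> is_functor (T \<up> n) B B"
  by (induction n) (auto simp: functor_simps)

section \<open>Natural transformations\<close>

lemma in_Ob_functor_cat [simp]: "F \<in> Ob (functor_cat A B) \<longleftrightarrow> is_functor F A B"
  by (simp add: functor_cat_def)

lemma functor_cat_sels [simp]:
  "Dom (functor_cat A B) = NDom" "Cod (functor_cat A B) = NCod"
  "Idn (functor_cat A B) = nid" "Comp (functor_cat A B) = vcomp"
  by (simp_all add: functor_cat_def)

lemma in_Arr_functor_cat:
  "\<alpha> \<in> Arr (functor_cat A B) \<longleftrightarrow> is_nat \<alpha> (NDom \<alpha>) (NCod \<alpha>) \<and> is_functor (NDom \<alpha>) A B"
  by (simp add: functor_cat_def)

lemma is_nat_in_Arr: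
  assumes "is_nat \<alpha> F H" "is_functor F A B"
  shows "\<alpha> \<in> Arr (functor_cat A B)" "NDom \<alpha> = F" "NCod \<alpha> = H"
  using assms by (auto simp: in_Arr_functor_cat is_nat_def)

lemma nat_functors:
  assumes "\<alpha> \<in> Arr (functor_cat A B)"
  shows "is_functor (NDom \<alpha>) A B" "is_functor (NCod \<alpha>) A B"
  using assms by (auto simp: in_Arr_functor_cat is_nat_def functor_simps)

lemma nat_category:
  assumes "\<alpha> \<in> Arr (functor_cat A B)"
  shows "category A" "category B"
  using nat_functors[OF assms] by (auto dest: functor_category)

lemma nat_NAt_arrow:
  assumes "\<alpha> \<in> Arr (functor_cat A B)" "x \<in> Ob A"
  shows "arrow B (NAt \<alpha> x) (FOb (NDom \<alpha>) x) (FOb (NCod \<alpha>) x)"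
  using assms functor_simps[OF nat_functors(1)[OF assms(1)]]
  by (auto simp: in_Arr_functor_cat is_nat_def)

lemma nat_NAt: "\<alpha> \<in> Arr (functor_cat A B) \<Longrightarrow> x \<in> Ob A \<Longrightarrow> NAt \<alpha> x \<in> Arr B"
  and nat_Dom: "\<alpha> \<in> Arr (functor_cat A B) \<Longrightarrow> x \<in> Ob A \<Longrightarrow> Dom B (NAt \<alpha> x) = FOb (NDom \<alpha>) x"
  and nat_Cod: "\<alpha> \<in> Arr (functor_cat A B) \<Longrightarrow> x \<in> Ob A \<Longrightarrow> Cod B (NAt \<alpha> x) = FOb (NCod \<alpha>) x"
  using nat_NAt_arrow[of \<alpha> A B x] by (auto simp: arrow_def)

lemma naturality:
  assumes "\<alpha> \<in> Arr (functor_cat A B)" "f \<in> Arr A" "Cod A f = y"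
  shows "Comp B (NAt \<alpha> y) (FArr (NDom \<alpha>) f) = Comp B (FArr (NCod \<alpha>) f) (NAt \<alpha> (Dom A f))"
proof -
  have "arrow A f (Dom A f) y"
    using assms nat_category[OF assms(1)] by (simp add: arrow_iff)
  then show ?thesis
    using assms(1) functor_simps[OF nat_functors(1)[OF assms(1)]]
    by (auto simp: in_Arr_functor_cat is_nat_def)
qed

lemmas nat_simps = nat_functors nat_NAt nat_Dom nat_Cod

lemma in_Arr_functor_catI:
  assumes "is_functor (NDom \<alpha>) A B" "is_functor (NCod \<alpha>) A B"
    and "NAt \<alpha> \<in> extensional (Ob A)"
    and "\<And>x. x \<in> Ob A \<Longrightarrow> NAt \<alpha> x \<in> Arr B \<and> Dom B (NAt \<alpha> x) = FOb (NDom \<alpha>) x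
           \<and> Cod B (NAt \<alpha> x) = FOb (NCod \<alpha>) x"
    and "\<And>f. f \<in> Arr A \<Longrightarrow> Comp B (NAt \<alpha> (Cod A f)) (FArr (NDom \<alpha>) f)
           = Comp B (FArr (NCod \<alpha>) f) (NAt \<alpha> (Dom A f))"
  shows "\<alpha> \<in> Arr (functor_cat A B)"
  unfolding in_Arr_functor_cat is_nat_def
  using assms functor_category[OF assms(1)] functor_FDom[OF assms(1)] functor_FCod[OF assms(1)]
  by (auto simp: arrow_iff)

lemma nat_eqI:
  assumes "\<alpha> \<in> Arr (functor_cat A B)" "\<beta> \<in> Arr (functor_cat A B)"
    and "NDom \<alpha> = NDom \<beta>" "NCod \<alpha> = NCod \<beta>"
    and "\<And>x. x \<in> Ob A \<Longrightarrow> NAt \<alpha> x = NAt \<beta> x"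
  shows "\<alpha> = \<beta>"
proof -
  have "FDom (NDom \<alpha>) = A" "FDom (NDom \<beta>) = A"
    using assms by (auto simp: in_Arr_functor_cat functor_simps)
  then have "NAt \<alpha> = NAt \<beta>"
    using assms by (auto simp: in_Arr_functor_cat is_nat_def intro!: extensionalityI)
  then show ?thesis using assms by simp
qed

lemma nid_simps [simp]:
  "NDom (nid F) = F" "NCod (nid F) = F"
  "x \<in> Ob (FDom F) \<Longrightarrow> NAt (nid F) x = Idn (FCod F) (FOb F x)"
  by (simp_all add: nid_def)

lemma vcomp_simps [simp]:
  "NDom (\<beta> \<odot> \<alpha>) = NDom \<alpha>" "NCod (\<beta> \<odot> \<alpha>) = NCod \<beta>"
  "x \<in> Ob (FDom (NDom \<alpha>)) \<Longrightarrow>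
     NAt (\<beta> \<odot> \<alpha>) x = Comp (FCod (NDom \<alpha>)) (NAt \<beta> x) (NAt \<alpha> x)"
  by (simp_all add: vcomp_def)

lemma whisker_left_simps [simp]:
  "NDom (F \<rhd> \<alpha>) = F \<cdot> NDom \<alpha>" "NCod (F \<rhd> \<alpha>) = F \<cdot> NCod \<alpha>"
  "x \<in> Ob (FDom (NDom \<alpha>)) \<Longrightarrow> NAt (F \<rhd> \<alpha>) x = FArr F (NAt \<alpha> x)"
  by (simp_all add: whisker_left_def)

lemma whisker_right_simps [simp]:
  "NDom (\<alpha> \<lhd> F) = NDom \<alpha> \<cdot> F" "NCod (\<alpha> \<lhd> F) = NCod \<alpha> \<cdot> F"
  "x \<in> Ob (FDom F) \<Longrightarrow> NAt (\<alpha> \<lhd> F) x = NAt \<alpha> (FOb F x)"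
  by (simp_all add: whisker_right_def)

lemma nid_nat [simp]:
  assumes "is_functor F A B"
  shows "nid F \<in> Arr (functor_cat A B)"
  using assms functor_simps[OF assms]
  by (intro in_Arr_functor_catI) (auto simp: nid_def)

lemma vcomp_nat [simp]:
  assumes "\<alpha> \<in> Arr (functor_cat A B)" "\<beta> \<in> Arr (functor_cat A B)" "NCod \<alpha> = NDom \<beta>"
  shows "\<beta> \<odot> \<alpha> \<in> Arr (functor_cat A B)"
proof -
  note [simp] = functor_simps[OF nat_functors(1)[OF assms(1)]]
    functor_simps[OF nat_functors(1)[OF assms(2)]] functor_simps[OF nat_functors(2)[OF assms(2)]]
    nat_simps[OF assms(1)] nat_simps[OF assms(2)] assms(3)
  show ?thesis
  proof (rule in_Arr_functor_catI, goal_cases)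
    case 3 then show ?case by (auto simp: vcomp_def)
  next
    case (5 f)
    note nat = naturality[OF assms(1) 5 refl] naturality[OF assms(2) 5 refl]
    show ?case using 5 nat Comp_tail[OF nat(2)] by simp
  qed simp_all
qed

lemma whisker_left_nat [simp]:
  assumes "\<alpha> \<in> Arr (functor_cat A (FDom F))" "is_functor F (FDom F) C"
  shows "F \<rhd> \<alpha> \<in> Arr (functor_cat A C)"
proof -
  note [simp] = functor_simps(1-2,4-)[OF assms(2)]
    functor_simps[OF nat_functors(1)[OF assms(1)]] functor_simps[OF nat_functors(2)[OF assms(1)]]
    nat_simps[OF assms(1)] assms(2)
  show ?thesis
  proof (rule in_Arr_functor_catI, goal_cases)
    case 3 then show ?case by (auto simp: whisker_left_def)
  next
    case (5 f)
    from arg_cong[OF naturality[OF assms(1) 5 refl], of "FArr F"] 5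
    show ?case by simp
  qed simp_all
qed

lemma whisker_right_nat [simp]:
  assumes "\<alpha> \<in> Arr (functor_cat (FCod F) C)" "is_functor F A (FCod F)"
  shows "\<alpha> \<lhd> F \<in> Arr (functor_cat A C)"
proof -
  note [simp] = functor_simps(1-3,5-)[OF assms(2)] functor_FOb[OF assms(2)]
    functor_simps[OF nat_functors(1)[OF assms(1)]] functor_simps[OF nat_functors(2)[OF assms(1)]]
    nat_simps[OF assms(1)] assms(2)
  show ?thesis
  proof (rule in_Arr_functor_catI, goal_cases)
    case 3 then show ?case by (auto simp: whisker_right_def)
  next
    case (5 f)
    then show ?case using naturality[OF assms(1), of "FArr F f"] by simp
  qed simp_all
qed

lemma functor_cat_arrow:
  "arrow (functor_cat A B) \<alpha> F H \<longleftrightarrow> \<alpha> \<in> Arr (functor_cat A B) \<and> NDom \<alpha> = F \<and> NCod \<alpha> = H"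
  by (auto simp: arrow_def nat_simps)

lemma category_functor_cat [simp]: "category (functor_cat A B)"
  unfolding category_def
proof (intro conjI ballI allI impI, goal_cases)
  case (7 f g h w x y z)
  then have fgh: "f \<in> Arr (functor_cat A B)" "g \<in> Arr (functor_cat A B)" "h \<in> Arr (functor_cat A B)"
    "NCod f = NDom g" "NCod g = NDom h"
    by (auto simp: functor_cat_arrow)
  note [simp] = functor_simps[OF nat_functors(1)[OF fgh(1)]]
    functor_simps[OF nat_functors(1)[OF fgh(2)]] functor_simps[OF nat_functors(1)[OF fgh(3)]] 
    nat_simps[OF fgh(1)] nat_simps[OF fgh(2)] nat_simps[OF fgh(3)] fgh
  show ?case by (rule nat_eqI[of _ A B]) simp_all
next
  case (5 f x y)
  then have f: "f \<in> Arr (functor_cat A B)" "NDom f = x" "NCod f = y" by (auto simp: functor_cat_arrow)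
  note f' = nat_functors[OF f(1)]
  note [simp] = nat_simps[OF f(1)] functor_simps[OF f'(1)] f(1)
  show ?case using f by (intro nat_eqI[of _ A B]) auto
next
  case (6 f x y)
  then have f: "f \<in> Arr (functor_cat A B)" "NDom f = x" "NCod f = y" by (auto simp: functor_cat_arrow)
  note f' = nat_functors[OF f(1)]
  note [simp] = nat_simps[OF f(1)] functor_simps[OF f'(1)] functor_simps[OF f'(2)] f(1)
  show ?case using f by (intro nat_eqI[of _ A B]) auto
qed (auto simp: nat_simps functor_cat_arrow)

section \<open>Comonads\<close>

locale comonad_on =
  fixes B :: "('o, 'm) cat" and T :: "('o, 'm) comonad"
  assumes comonad: "is_comonad B T"
begin

lemma Fn_functor [simp]: "is_functor (Fn T) B B"
  using comonad by (simp add: is_comonad_def)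

lemmas Fn_simps [simp] = functor_simps[OF Fn_functor]

lemma fpow_functor_Fn [simp]: "is_functor (Fn T \<up> n) B B"
  by (rule fpow_functor[OF Fn_functor])

lemmas fpow_Fn_simps [simp] = functor_simps[OF fpow_functor_Fn]

lemma fpow_swap_FOb [simp]:
  "x \<in> Ob B \<Longrightarrow> FOb (Fn T \<up> n) (FOb (Fn T) x) = FOb (Fn T) (FOb (Fn T \<up> n) x)"
  by (induction n) simp_all

lemma fpow_swap_FArr [simp]:
  "f \<in> Arr B \<Longrightarrow> FArr (Fn T \<up> n) (FArr (Fn T) f) = FArr (Fn T) (FArr (Fn T \<up> n) f)"
  by (induction n) simp_all

text \<open>Words in \<open>T\<close> and its powers are normalised by moving single factors \<open>T\<close> to the front, so that sources and
targets of whiskered transformations that differ in where a power is split become equal.\<close>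

lemma fpow_swap_fcomp [simp]:
  assumes "is_functor H (FDom H) B"
  shows "Fn T \<up> n \<cdot> Fn T \<cdot> H = Fn T \<cdot> Fn T \<up> n \<cdot> H"
  using assms functor_simps[OF assms] by (induction n) simp_all

lemma fpow_add_fcomp [simp]:
  assumes "is_functor H (FDom H) B"
  shows "Fn T \<up> m \<cdot> Fn T \<up> n \<cdot> H = Fn T \<up> (m + n) \<cdot> H"
  using assms functor_simps[OF assms] by (induction m) simp_all

lemma \<delta>_nat [simp]:
  "\<delta> T \<in> Arr (functor_cat B B)" "NDom (\<delta> T) = Fn T" "NCod (\<delta> T) = Fn T \<cdot> Fn T"
  and \<epsilon>_nat [simp]:
  "\<epsilon> T \<in> Arr (functor_cat B B)" "NDom (\<epsilon> T) = Fn T" "NCod (\<epsilon> T) = fid B"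
  using comonad is_nat_in_Arr[of "\<delta> T" _ _ B B] is_nat_in_Arr[of "\<epsilon> T" _ _ B B]
  unfolding is_comonad_def by blast+

lemmas \<delta>_simps [simp] = nat_simps[OF \<delta>_nat(1)]
lemmas \<epsilon>_simps [simp] = nat_simps[OF \<epsilon>_nat(1)]

lemma \<delta>_natural:
  "f \<in> Arr B \<Longrightarrow> Cod B f = y \<Longrightarrow> Comp B (NAt (\<delta> T) y) (FArr (Fn T) f)
     = Comp B (FArr (Fn T) (FArr (Fn T) f)) (NAt (\<delta> T) (Dom B f))"
  using naturality[OF \<delta>_nat(1), of f y] by simp

lemma \<epsilon>_natural:
  "f \<in> Arr B \<Longrightarrow> Cod B f = y \<Longrightarrow> Comp B (NAt (\<epsilon> T) y) (FArr (Fn T) f)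
     = Comp B f (NAt (\<epsilon> T) (Dom B f))"
  using naturality[OF \<epsilon>_nat(1), of f y] by simp

lemma coassoc:
  assumes "x \<in> Ob B"
  shows "Comp B (NAt (\<delta> T) (FOb (Fn T) x)) (NAt (\<delta> T) x)
     = Comp B (FArr (Fn T) (NAt (\<delta> T) x)) (NAt (\<delta> T) x)"
proof -
  have "(\<delta> T \<lhd> Fn T) \<odot> \<delta> T = (Fn T \<rhd> \<delta> T) \<odot> \<delta> T"
    using comonad by (simp add: is_comonad_def)
  from arg_cong[OF this, of "\<lambda>\<alpha>. NAt \<alpha> x"] assms show ?thesis by simp
qed

lemma counit:
  assumes "x \<in> Ob B"
  shows "Comp B (NAt (\<epsilon> T) (FOb (Fn T) x)) (NAt (\<delta> T) x) = Idn B (FOb (Fn T) x)"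
    and "Comp B (FArr (Fn T) (NAt (\<epsilon> T) x)) (NAt (\<delta> T) x) = Idn B (FOb (Fn T) x)"
proof -
  have "(\<epsilon> T \<lhd> Fn T) \<odot> \<delta> T = nid (Fn T)" "(Fn T \<rhd> \<epsilon> T) \<odot> \<delta> T = nid (Fn T)"
    using comonad by (simp_all add: is_comonad_def)
  from arg_cong[OF this(1), of "\<lambda>\<alpha>. NAt \<alpha> x"] arg_cong[OF this(2), of "\<lambda>\<alpha>. NAt \<alpha> x"] assms
  show "Comp B (NAt (\<epsilon> T) (FOb (Fn T) x)) (NAt (\<delta> T) x) = Idn B (FOb (Fn T) x)"
    and "Comp B (FArr (Fn T) (NAt (\<epsilon> T) x)) (NAt (\<delta> T) x) = Idn B (FOb (Fn T) x)"
    by simp_all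
qed

end

section \<open>The simplicial object of a comonad at an object\<close>

definition bar_face :: "('o, 'm) comonad \<Rightarrow> 'o \<Rightarrow> nat \<Rightarrow> nat \<Rightarrow> 'm" where
  "bar_face T b n i = FArr (Fn T \<up> i) (NAt (\<epsilon> T) (FOb (Fn T \<up> (n - i)) b))"

definition bar_degen :: "('o, 'm) comonad \<Rightarrow> 'o \<Rightarrow> nat \<Rightarrow> nat \<Rightarrow> 'm" where
  "bar_degen T b n j = FArr (Fn T \<up> j) (NAt (\<delta> T) (FOb (Fn T \<up> (n - j)) b))"

definition bar_at :: "('o, 'm) comonad \<Rightarrow> 'o \<Rightarrow> ('o, 'm) simp_obj" where
  "bar_at T b = \<lparr> obj = (\<lambda>n. FOb (Fn T \<up> (n + 1)) b), face = bar_face T b, degen = bar_degen T b \<rparr>"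

lemma bar_at_sels [simp]:
  "obj (bar_at T b) n = FOb (Fn T \<up> (n + 1)) b"
  "face (bar_at T b) = bar_face T b" "degen (bar_at T b) = bar_degen T b"
  by (simp_all add: bar_at_def)

context comonad_on
begin

text \<open>Faces and degeneracies of positive index are images under \<open>T\<close> of those one degree lower. This recursion
reduces every identity below to index \<open>0\<close>, where it is naturality or a comonad axiom.\<close>

lemma bar_face_0: "b \<in> Ob B \<Longrightarrow> bar_face T b n 0 = NAt (\<epsilon> T) (FOb (Fn T \<up> n) b)"
  and bar_face_Suc: "b \<in> Ob B \<Longrightarrow> bar_face T b (Suc n) (Suc i) = FArr (Fn T) (bar_face T b n i)"
  and bar_face_last: "bar_face T b n n = FArr (Fn T \<up> n) (NAt (\<epsilon> T) (FOb (fid B) b))"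
  by (simp_all add: bar_face_def)

lemma bar_degen_0: "b \<in> Ob B \<Longrightarrow> bar_degen T b n 0 = NAt (\<delta> T) (FOb (Fn T \<up> n) b)"
  and bar_degen_Suc: "b \<in> Ob B \<Longrightarrow> bar_degen T b (Suc n) (Suc i) = FArr (Fn T) (bar_degen T b n i)"
  and bar_degen_last: "bar_degen T b n n = FArr (Fn T \<up> n) (NAt (\<delta> T) (FOb (fid B) b))"
  by (simp_all add: bar_degen_def)

lemma bar_face_simps [simp]:
  assumes "b \<in> Ob B" "i \<le> n"
  shows "bar_face T b n i \<in> Arr B"
    and "Dom B (bar_face T b n i) = FOb (Fn T) (FOb (Fn T \<up> n) b)"
    and "Cod B (bar_face T b n i) = FOb (Fn T \<up> n) b"
proof -
  have "bar_face T b n i \<in> Arr B \<and> Dom B (bar_face T b n i) = FOb (Fn T) (FOb (Fn T \<up> n) b)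
    \<and> Cod B (bar_face T b n i) = FOb (Fn T \<up> n) b"
    using assms(2)
  proof (induction i arbitrary: n)
    case (Suc i)
    then obtain m where "n = Suc m" by (cases n) auto
    with Suc assms(1) show ?case by (simp add: bar_face_Suc)
  qed (simp add: bar_face_0 assms(1))
  then show "bar_face T b n i \<in> Arr B"
    and "Dom B (bar_face T b n i) = FOb (Fn T) (FOb (Fn T \<up> n) b)"
    and "Cod B (bar_face T b n i) = FOb (Fn T \<up> n) b" by auto
qed

lemma bar_degen_simps [simp]:
  assumes "b \<in> Ob B" "j \<le> n"
  shows "bar_degen T b n j \<in> Arr B"
    and "Dom B (bar_degen T b n j) = FOb (Fn T) (FOb (Fn T \<up> n) b)"
    and "Cod B (bar_degen T b n j) = FOb (Fn T) (FOb (Fn T) (FOb (Fn T \<up> n) b))"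
proof -
  have "bar_degen T b n j \<in> Arr B \<and> Dom B (bar_degen T b n j) = FOb (Fn T) (FOb (Fn T \<up> n) b)
    \<and> Cod B (bar_degen T b n j) = FOb (Fn T) (FOb (Fn T) (FOb (Fn T \<up> n) b))"
    using assms(2)
  proof (induction j arbitrary: n)
    case (Suc j)
    then obtain m where "n = Suc m" by (cases n) auto
    with Suc assms(1) show ?case by (simp add: bar_degen_Suc)
  qed (simp add: bar_degen_0 assms(1))
  then show "bar_degen T b n j \<in> Arr B"
    and "Dom B (bar_degen T b n j) = FOb (Fn T) (FOb (Fn T \<up> n) b)"
    and "Cod B (bar_degen T b n j) = FOb (Fn T) (FOb (Fn T) (FOb (Fn T \<up> n) b))" by auto
qed

text \<open>Evaluating at \<open>T b\<close> instead of \<open>b\<close> raises the degree but keeps the index; this is how an index drops by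
one relative to the degree when a face moves past the duplicial operator.\<close>

lemma bar_face_shift: "b \<in> Ob B \<Longrightarrow> i \<le> n \<Longrightarrow> bar_face T (FOb (Fn T) b) n i = bar_face T b (Suc n) i"
  by (simp add: bar_face_def Suc_diff_le)

lemma bar_degen_shift: "b \<in> Ob B \<Longrightarrow> i \<le> n \<Longrightarrow> bar_degen T (FOb (Fn T) b) n i = bar_degen T b (Suc n) i"
  by (simp add: bar_degen_def Suc_diff_le)

lemma bar_face_natural:
  assumes "f \<in> Arr B" "i \<le> n"
  shows "Comp B (bar_face T (Cod B f) n i) (FArr (Fn T) (FArr (Fn T \<up> n) f))
    = Comp B (FArr (Fn T \<up> n) f) (bar_face T (Dom B f) n i)"
  using assms(2)
proof (induction i arbitrary: n)
  case 0
  then show ?case using assms(1) by (simp add: bar_face_0 \<epsilon>_natural)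
next
  case (Suc i)
  then obtain m where [simp]: "n = Suc m" "i \<le> m" by (cases n) auto
  from arg_cong[OF Suc.IH[of m], of "FArr (Fn T)"] assms(1) show ?case
    by (simp add: bar_face_Suc)
qed

lemma bar_degen_natural:
  assumes "f \<in> Arr B" "j \<le> n"
  shows "Comp B (bar_degen T (Cod B f) n j) (FArr (Fn T) (FArr (Fn T \<up> n) f))
    = Comp B (FArr (Fn T) (FArr (Fn T) (FArr (Fn T \<up> n) f))) (bar_degen T (Dom B f) n j)"
  using assms(2)
proof (induction j arbitrary: n)
  case 0
  then show ?case using assms(1) by (simp add: bar_degen_0 \<delta>_natural)
next
  case (Suc j)
  then obtain m where [simp]: "n = Suc m" "j \<le> m" by (cases n) auto
  from arg_cong[OF Suc.IH[of m], of "FArr (Fn T)"] assms(1) show ?case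
    by (simp add: bar_degen_Suc)
qed

lemma bar_face_face:
  assumes b: "b \<in> Ob B" and "i \<le> j" "j \<le> n"
  shows "Comp B (bar_face T b n i) (bar_face T b (Suc n) (Suc j)) =
    Comp B (bar_face T b n j) (bar_face T b (Suc n) i)"
  using assms(2-)
proof (induction i arbitrary: n j)
  case 0
  then show ?case using b by (simp add: bar_face_0 bar_face_Suc \<epsilon>_natural)
next
  case (Suc i)
  then obtain k m where [simp]: "j = Suc k" "n = Suc m" by (cases j; cases n) auto
  have [simp]: "i \<le> k" "k \<le> m" "i \<le> m" "i \<le> Suc m" using Suc.prems by auto
  from arg_cong[OF Suc.IH[of k m], of "FArr (Fn T)"] b show ?case
    by (simp add: bar_face_Suc)
qed

lemma bar_degen_degen:
  assumes b: "b \<in> Ob B" and "i \<le> j" "j \<le> n"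
  shows "Comp B (bar_degen T b (Suc n) i) (bar_degen T b n j) =
    Comp B (bar_degen T b (Suc n) (Suc j)) (bar_degen T b n i)"
  using assms(2-)
proof (induction i arbitrary: n j)
  case 0
  show ?case
  proof (cases j)
    case 0
    with b show ?thesis by (simp add: bar_degen_0 bar_degen_Suc coassoc)
  next
    case [simp]: (Suc k)
    with 0 obtain m where [simp]: "n = Suc m" "k \<le> m" by (cases n) auto
    from b show ?thesis by (simp add: bar_degen_0 bar_degen_Suc \<delta>_natural)
  qed
next
  case (Suc i)
  then obtain k m where [simp]: "j = Suc k" "n = Suc m" by (cases j; cases n) auto
  have [simp]: "i \<le> k" "k \<le> m" "i \<le> m" "i \<le> Suc m" using Suc.prems by auto
  from arg_cong[OF Suc.IH[of k m], of "FArr (Fn T)"] b show ?case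
    by (simp add: bar_degen_Suc)
qed

lemma bar_face_degen_less:
  assumes b: "b \<in> Ob B" and "i \<le> j" "j \<le> n"
  shows "Comp B (bar_face T b (Suc (Suc n)) i) (bar_degen T b (Suc n) (Suc j)) =
    Comp B (bar_degen T b n j) (bar_face T b (Suc n) i)"
  using assms(2-)
proof (induction i arbitrary: n j)
  case 0
  then show ?case using b by (simp add: bar_face_0 bar_degen_Suc \<epsilon>_natural)
next
  case (Suc i)
  then obtain k m where [simp]: "j = Suc k" "n = Suc m" by (cases j; cases n) auto
  have [simp]: "i \<le> k" "k \<le> m" "i \<le> m" "i \<le> Suc m" "i \<le> Suc (Suc m)" using Suc.prems by auto
  from arg_cong[OF Suc.IH[of k m], of "FArr (Fn T)"] b show ?case
    by (simp add: bar_degen_Suc bar_face_Suc)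
qed

lemma bar_face_degen_eq:
  assumes b: "b \<in> Ob B" and "j \<le> n"
  shows "Comp B (bar_face T b (Suc n) j) (bar_degen T b n j) = Idn B (FOb (Fn T) (FOb (Fn T \<up> n) b))"
    and "Comp B (bar_face T b (Suc n) (Suc j)) (bar_degen T b n j) = Idn B (FOb (Fn T) (FOb (Fn T \<up> n) b))"
  using assms(2)
proof (induction j arbitrary: n)
  case 0
  { case 1 show ?case using b by (simp add: bar_face_0 bar_degen_0 counit) }
  { case 2 show ?case using b by (simp add: bar_face_0 bar_face_Suc bar_degen_0 counit) }
next
  case (Suc j)
  { case 1
    then obtain m where [simp]: "n = Suc m" "j \<le> m" "j \<le> Suc m" by (cases n) auto
    from arg_cong[OF Suc.IH(1)[of m], of "FArr (Fn T)"] b show ?case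
      by (simp add: bar_degen_Suc bar_face_Suc) }
  { case 2
    then obtain m where [simp]: "n = Suc m" "j \<le> m" by (cases n) auto
    from arg_cong[OF Suc.IH(2)[of m], of "FArr (Fn T)"] b show ?case
      by (simp add: bar_degen_Suc bar_face_Suc) }
qed

lemma bar_face_degen_greater:
  assumes b: "b \<in> Ob B" and "j < i" "i \<le> Suc n"
  shows "Comp B (bar_face T b (Suc (Suc n)) (Suc i)) (bar_degen T b (Suc n) j) =
    Comp B (bar_degen T b n j) (bar_face T b (Suc n) i)"
  using assms(2-)
proof (induction j arbitrary: n i)
  case 0
  then obtain k where [simp]: "i = Suc k" "k \<le> n" by (cases i) auto
  show ?case using b
    by (simp add: bar_face_Suc bar_degen_0 \<delta>_natural)
next
  case (Suc j)
  then obtain k m where [simp]: "i = Suc k" "n = Suc m" by (cases i; cases n) auto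
  have [simp]: "j < k" "k \<le> Suc m" "j \<le> m" "j \<le> Suc m" using Suc.prems by auto
  from arg_cong[OF Suc.IH[of k m], of "FArr (Fn T)"] b show ?case
    by (simp add: bar_degen_Suc bar_face_Suc)
qed

lemma simplicial_bar_at:
  assumes b: "b \<in> Ob B"
  shows "simplicial B (bar_at T b)"
  unfolding simplicial_def
proof (intro conjI allI impI, goal_cases)
  case (5 n i j)
  then obtain k where "j = Suc k" by (cases j) auto
  with 5 b bar_face_face[of b i k "Suc n"] show ?case by simp
next
  case (6 n i j)
  with b bar_degen_degen[of b i j n] show ?case by simp
next
  case (7 n i j)
  then obtain k m where "j = Suc k" "n = Suc m" by (cases j; cases n) auto
  with 7 b bar_face_degen_less[of b i k m] show ?case by simp
next
  case (8 n i j)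
  with b bar_face_degen_eq[of b j n] show ?case by auto
next
  case (9 n i j)
  then obtain k m where "i = Suc k" "n = Suc m" by (cases i; cases n) auto
  with 9 b bar_face_degen_greater[of b j k m] show ?case by simp
qed (use b in \<open>simp_all add: arrow_iff\<close>)

end

definition map_simp_obj :: "('o, 'm, 'p, 'n) ftor \<Rightarrow> ('o, 'm) simp_obj \<Rightarrow> ('p, 'n) simp_obj" where
  "map_simp_obj F Z = \<lparr> obj = (\<lambda>n. FOb F (obj Z n)), face = (\<lambda>n i. FArr F (face Z n i)),
     degen = (\<lambda>n j. FArr F (degen Z n j)) \<rparr>"

definition opposite_simp_obj :: "('o, 'm) simp_obj \<Rightarrow> ('o, 'm) simp_obj" where
  "opposite_simp_obj Z = \<lparr> obj = obj Z, face = (\<lambda>n i. face Z n (n - i)),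
     degen = (\<lambda>n j. degen Z n (n - j)) \<rparr>"

lemma simplicialD:
  assumes "simplicial K Z"
  shows "category K" "obj Z n \<in> Ob K"
    and "i \<le> Suc n \<Longrightarrow> arrow K (face Z (Suc n) i) (obj Z (Suc n)) (obj Z n)"
    and "j \<le> n \<Longrightarrow> arrow K (degen Z n j) (obj Z n) (obj Z (Suc n))"
    and "i < j \<Longrightarrow> j \<le> n + 2 \<Longrightarrow> Comp K (face Z (n + 1) i) (face Z (n + 2) j) =
        Comp K (face Z (n + 1) (j - 1)) (face Z (n + 2) i)"
    and "i \<le> j \<Longrightarrow> j \<le> n \<Longrightarrow> Comp K (degen Z (n + 1) i) (degen Z n j) =
        Comp K (degen Z (n + 1) (j + 1)) (degen Z n i)"
    and "i < j \<Longrightarrow> j \<le> n \<Longrightarrow> Comp K (face Z (n + 1) i) (degen Z n j) =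
        Comp K (degen Z (n - 1) (j - 1)) (face Z n i)"
    and "i = j \<or> i = j + 1 \<Longrightarrow> j \<le> n \<Longrightarrow>
        Comp K (face Z (n + 1) i) (degen Z n j) = Idn K (obj Z n)"
    and "j + 1 < i \<Longrightarrow> i \<le> n + 1 \<Longrightarrow> Comp K (face Z (n + 1) i) (degen Z n j) =
        Comp K (degen Z (n - 1) j) (face Z n (i - 1))"
  by (insert assms[unfolded simplicial_def], (elim conjE, simp only:)+)

lemma simplicial_map:
  assumes "simplicial B Z" "is_functor F B Y"
  shows "simplicial Y (map_simp_obj F Z)"
proof -
  note [simp] = functor_simps[OF assms(2)] simplicialD(2)[OF assms(1)]
  note Z = simplicialD[OF assms(1)]
  have [simp]: "face Z (Suc n) i \<in> Arr B" "Dom B (face Z (Suc n) i) = obj Z (Suc n)"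
    "Cod B (face Z (Suc n) i) = obj Z n" if "i \<le> Suc n" for n i
    using Z(3)[OF that] Z(1) by (auto simp: arrow_iff)
  have [simp]: "degen Z n i \<in> Arr B" "Dom B (degen Z n i) = obj Z n"
    "Cod B (degen Z n i) = obj Z (Suc n)" if "i \<le> n" for n i
    using Z(4)[OF that] Z(1) by (auto simp: arrow_iff)
  show ?thesis
    unfolding simplicial_def map_simp_obj_def
  proof (intro conjI allI impI, goal_cases)
    case (5 n i j)
    then have "j - 1 \<le> Suc n" "i \<le> Suc n" "i \<le> Suc (Suc n)" by auto
    with arg_cong[OF Z(5)[of i j n], of "FArr F"] 5 show ?case by simp
  next
    case (6 n i j)
    from arg_cong[OF Z(6)[of i j n], of "FArr F"] 6 show ?case by simp
  next
    case (7 n i j)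
    then obtain m where "n = Suc m" "i \<le> Suc m" "j - 1 \<le> m" by (cases n) auto
    with arg_cong[OF Z(7)[of i j n], of "FArr F"] 7 show ?case by simp
  next
    case (8 n i j)
    from arg_cong[OF Z(8)[of i j n], of "FArr F"] 8 show ?case by auto
  next
    case (9 n i j)
    then obtain m where "n = Suc m" "j \<le> m" "i - 1 \<le> Suc m" by (cases n) auto
    with arg_cong[OF Z(9)[of j i n], of "FArr F"] 9 show ?case by simp
  qed (simp_all add: arrow_iff)
qed

lemma simplicial_opposite:
  assumes "simplicial K Z"
  shows "simplicial K (opposite_simp_obj Z)"
proof -
  note Z = simplicialD[OF assms]
  show ?thesis
    unfolding simplicial_def opposite_simp_obj_def
  proof (intro conjI allI impI, goal_cases)
    case (5 n i j)
    then have "n + 2 - j < n + 2 - i" "n + 2 - i - 1 = n + 1 - i" "n + 1 - (j - 1) = n + 2 - j"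
      by auto
    with Z(5)[of "n + 2 - j" "n + 2 - i" n] 5 show ?case
      by (simp add: numeral_2_eq_2 Suc_diff_le)
  next
    case (6 n i j)
    then have "n - j \<le> n - i" by auto
    with Z(6)[of "n - j" "n - i" n] 6 show ?case by (simp add: Suc_diff_le)
  next
    case (7 n i j)
    then have "n - j + 1 < n + 1 - i" "n - 1 - (j - 1) = n - j" "n + 1 - i - 1 = n - i" by linarith+
    with Z(9)[of "n - j" "n + 1 - i" n] 7 show ?case by simp
  next
    case (8 n i j)
    then have "n + 1 - i = n - j \<or> n + 1 - i = n - j + 1" by auto
    with Z(8)[of "n + 1 - i" "n - j" n] 8 show ?case by simp
  next
    case (9 n i j)
    then have "n + 1 - i < n - j" "n - (i - 1) = n + 1 - i" "n - 1 - j = n - j - 1" by linarith+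
    with Z(7)[of "n + 1 - i" "n - j" n] 9 show ?case by simp
  qed (simp_all add: Z(1-4))
qed

section \<open>Duplicial objects in functor categories\<close>

text \<open>Faces and degeneracies outside the meaningful range of indices carry arbitrary values, so agreement is
required only inside it.\<close>

lemma simplicial_cong:
  assumes Z': "simplicial K Z'"
    and obj: "\<And>n. obj Z n = obj Z' n"
    and face: "\<And>n i. i \<le> n \<Longrightarrow> face Z n i = face Z' n i"
    and degen: "\<And>n j. j \<le> n \<Longrightarrow> degen Z n j = degen Z' n j"
  shows "simplicial K Z"
  unfolding simplicial_def
proof (intro conjI allI impI, goal_cases)
  case (5 n i j)
  then have "i \<le> n + 1" "j - 1 \<le> n + 1" "i \<le> n + 2" by auto
  with 5 simplicialD(5)[OF Z', of i j n] show ?case by (simp only: face)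
next
  case (6 n i j)
  then have "i \<le> n + 1" "j + 1 \<le> n + 1" "i \<le> n" by auto
  with 6 simplicialD(6)[OF Z', of i j n] show ?case by (simp only: degen)
next
  case (7 n i j)
  then have "i \<le> n + 1" "j - 1 \<le> n - 1" "i \<le> n" by auto
  with 7 simplicialD(7)[OF Z', of i j n] show ?case by (simp only: face degen)
next
  case (8 n i j)
  then have "i \<le> n + 1" by auto
  with 8 simplicialD(8)[OF Z', of i j n] show ?case by (simp only: face degen obj)
next
  case (9 n i j)
  then have "j \<le> n" "j \<le> n - 1" "i - 1 \<le> n" by auto
  with 9 simplicialD(9)[OF Z', of j i n] show ?case by (simp only: face degen)
qed (simp_all add: obj face degen simplicialD[OF Z'] del: One_nat_def)

definition eval_at :: "'o \<Rightarrow> (('o, 'm, 'p, 'n) ftor, ('o, 'm, 'p, 'n) ntrans) dupl_obj \<Rightarrow> ('p, 'n) dupl_obj"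
  where
  "eval_at x Z = \<lparr> obj = (\<lambda>n. FOb (obj Z n) x), face = (\<lambda>n i. NAt (face Z n i) x),
     degen = (\<lambda>n j. NAt (degen Z n j) x), tt = (\<lambda>n. NAt (tt Z n) x) \<rparr>"

lemma eval_at_sels [simp]:
  "obj (eval_at x Z) n = FOb (obj Z n) x" "face (eval_at x Z) n i = NAt (face Z n i) x"
  "degen (eval_at x Z) n i = NAt (degen Z n i) x" "tt (eval_at x Z) n = NAt (tt Z n) x"
  by (simp_all add: eval_at_def)

lemma duplicialD:
  assumes "duplicial K Z"
  shows "simplicial K Z" "arrow K (tt Z n) (obj Z n) (obj Z n)"
    and "1 \<le> i \<Longrightarrow> i \<le> n \<Longrightarrow> Comp K (face Z n i) (tt Z n) = Comp K (tt Z (n - 1)) (face Z n (i - 1))"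
    and "1 \<le> n \<Longrightarrow> Comp K (face Z n 0) (tt Z n) = face Z n n"
    and "1 \<le> j \<Longrightarrow> j \<le> n \<Longrightarrow> Comp K (degen Z n j) (tt Z n) = Comp K (tt Z (n + 1)) (degen Z n (j - 1))"
    and "Comp K (degen Z n 0) (tt Z n) = Comp K (tt Z (n + 1)) (Comp K (tt Z (n + 1)) (degen Z n n))"
  by (insert assms[unfolded duplicial_def], (elim conjE, simp only:)+)

text \<open>Evaluation at all objects of \<open>X\<close> is jointly faithful on natural transformations, so the identities in the
functor category follow from those at each object once the types are known.\<close>

locale pointwise_duplicial =
  fixes X :: "('o, 'm) cat" and Y :: "('p, 'n) cat"
    and Z :: "(('o, 'm, 'p, 'n) ftor, ('o, 'm, 'p, 'n) ntrans) dupl_obj"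
  assumes obj: "is_functor (obj Z n) X Y"
    and face: "i \<le> Suc n \<Longrightarrow> arrow (functor_cat X Y) (face Z (Suc n) i) (obj Z (Suc n)) (obj Z n)"
    and degen: "j \<le> n \<Longrightarrow> arrow (functor_cat X Y) (degen Z n j) (obj Z n) (obj Z (Suc n))"
    and tt: "arrow (functor_cat X Y) (tt Z n) (obj Z n) (obj Z n)"
    and duplicial_at: "x \<in> Ob X \<Longrightarrow> duplicial Y (eval_at x Z)"
begin

lemmas obj_simps [simp] = obj functor_simps[OF obj]

lemma face_nat [simp]:
  assumes "i \<le> Suc n"
  shows "face Z (Suc n) i \<in> Arr (functor_cat X Y)"
    and "NDom (face Z (Suc n) i) = obj Z (Suc n)" "NCod (face Z (Suc n) i) = obj Z n"
  using face[OF assms] by (auto simp: functor_cat_arrow)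

lemma degen_nat [simp]:
  assumes "j \<le> n"
  shows "degen Z n j \<in> Arr (functor_cat X Y)"
    and "NDom (degen Z n j) = obj Z n" "NCod (degen Z n j) = obj Z (Suc n)"
  using degen[OF assms] by (auto simp: functor_cat_arrow)

lemma tt_nat [simp]:
  shows "tt Z n \<in> Arr (functor_cat X Y)" "NDom (tt Z n) = obj Z n" "NCod (tt Z n) = obj Z n"
  using tt by (auto simp: functor_cat_arrow)

lemmas dupl_at = duplicialD[OF duplicial_at]
lemmas simp_at = simplicialD[OF dupl_at(1)]

lemma simplicial: "simplicial (functor_cat X Y) Z"
  unfolding simplicial_def
proof (intro conjI allI impI, goal_cases)
  case (5 n i j)
  then have "i \<le> Suc n" "j - 1 \<le> Suc n" "i \<le> Suc (Suc n)" by auto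
  with 5 simp_at(5)[of _ i j n] show ?case by (intro nat_eqI[of _ X Y]) simp_all
next
  case (6 n i j)
  with simp_at(6)[of _ i j n] show ?case by (intro nat_eqI[of _ X Y]) simp_all
next
  case (7 n i j)
  then obtain m where "n = Suc m" "i \<le> Suc m" "j - 1 \<le> m" by (cases n) auto
  with 7 simp_at(7)[of _ i j n] show ?case by (intro nat_eqI[of _ X Y]) simp_all
next
  case (8 n i j)
  then have "i \<le> Suc n" by auto
  with 8 simp_at(8)[of _ i j n] show ?case
    by (intro nat_eqI[of _ X Y]) auto
next
  case (9 n i j)
  then obtain m where "n = Suc m" "j \<le> m" "i - 1 \<le> Suc m" by (cases n) auto
  with 9 simp_at(9)[of _ j i n] show ?case by (intro nat_eqI[of _ X Y]) simp_all
qed (simp_all add: face degen)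

lemma duplicial: "duplicial (functor_cat X Y) Z"
  unfolding duplicial_def
proof (intro conjI allI impI, goal_cases)
  case (3 n i)
  then obtain m where "n = Suc m" "i - 1 \<le> Suc m" by (cases n) auto
  with 3 dupl_at(3)[of _ i n] show ?case by (intro nat_eqI[of _ X Y]) simp_all
next
  case (4 n)
  then obtain m where "n = Suc m" by (cases n) auto
  with 4 dupl_at(4)[of _ n] show ?case by (intro nat_eqI[of _ X Y]) simp_all
next
  case (5 n j)
  then have "j - 1 \<le> n" by auto
  with 5 dupl_at(5)[of _ j n] show ?case by (intro nat_eqI[of _ X Y]) simp_all
next
  case (6 n)
  with dupl_at(6)[of _ n] show ?case by (intro nat_eqI[of _ X Y]) simp_all
qed (simp_all add: simplicial tt)

end

lemma duplicial_morphism_pointwise: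
  assumes Z: "duplicial (functor_cat X Y) Z" and W: "duplicial (functor_cat X Y) W"
    and f: "\<And>n. arrow (functor_cat X Y) (f n) (obj Z n) (obj W n)"
    and face_f: "\<And>n i x. i \<le> Suc n \<Longrightarrow> x \<in> Ob X \<Longrightarrow>
      Comp Y (NAt (face W (Suc n) i) x) (NAt (f (Suc n)) x) =
      Comp Y (NAt (f n) x) (NAt (face Z (Suc n) i) x)"
    and degen_f: "\<And>n j x. j \<le> n \<Longrightarrow> x \<in> Ob X \<Longrightarrow>
      Comp Y (NAt (degen W n j) x) (NAt (f n) x) =
      Comp Y (NAt (f (Suc n)) x) (NAt (degen Z n j) x)"
    and tt_f: "\<And>n x. x \<in> Ob X \<Longrightarrow>
      Comp Y (NAt (tt W n) x) (NAt (f n) x) = Comp Y (NAt (f n) x) (NAt (tt Z n) x)"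
  shows "duplicial_morphism (functor_cat X Y) Z W f"
proof -
  note Zs = simplicialD[OF duplicialD(1)[OF Z]] and Ws = simplicialD[OF duplicialD(1)[OF W]]
  have *: "is_functor (obj Z n) X Y" "is_functor (obj W n) X Y" for n
    using Zs(2) Ws(2) by simp_all
  note [simp] = functor_simps[OF *(1)] functor_simps[OF *(2)]
    f[unfolded functor_cat_arrow] duplicialD(2)[OF Z, unfolded functor_cat_arrow]
    duplicialD(2)[OF W, unfolded functor_cat_arrow]
    Zs(3,4)[unfolded functor_cat_arrow] Ws(3,4)[unfolded functor_cat_arrow]
  show ?thesis
    unfolding duplicial_morphism_def simplicial_morphism_def
  proof (intro conjI allI impI, goal_cases)
    case (6 n i)
    with face_f show ?case by (intro nat_eqI[of _ X Y]) simp_all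
  next
    case (7 n j)
    with degen_f show ?case by (intro nat_eqI[of _ X Y]) simp_all
  next
    case (8 n)
    with tt_f show ?case by (intro nat_eqI[of _ X Y]) simp_all
  qed (use Z W f in \<open>simp_all add: duplicialD(1)\<close>)
qed

section \<open>Morphisms and opmorphisms of comonads\<close>

declare iter_l.simps(2) [simp del] iter_r.simps(2) [simp del]

text \<open>The transformations \<open>\<sigma>: G\<Sigma> \<Rightarrow> \<Sigma>T\<close> and \<open>\<chi>: TS \<Rightarrow> ST\<close> (with \<open>\<Sigma> = S\<close> and \<open>G = T\<close>) are both instances.\<close>

locale comonad_morphism =
  src: comonad_on B T + tgt: comonad_on D G
  for B :: "('o, 'm) cat" and T and D :: "('p, 'n) cat" and G +
  fixes \<Sigma> \<sigma>
  assumes \<Sigma>_functor [simp]: "is_functor \<Sigma> B D"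
    and \<sigma>: "is_nat \<sigma> (Fn G \<cdot> \<Sigma>) (\<Sigma> \<cdot> Fn T)"
    and \<sigma>_\<delta>_eq: "(\<Sigma> \<rhd> \<delta> T) \<odot> \<sigma> = (\<sigma> \<lhd> Fn T) \<odot> (Fn G \<rhd> \<sigma>) \<odot> (\<delta> G \<lhd> \<Sigma>)"
    and \<sigma>_\<epsilon>_eq: "(\<Sigma> \<rhd> \<epsilon> T) \<odot> \<sigma> = \<epsilon> G \<lhd> \<Sigma>"
begin

lemmas \<Sigma>_simps [simp] = functor_simps[OF \<Sigma>_functor]

lemma \<sigma>_nat [simp]:
  "\<sigma> \<in> Arr (functor_cat B D)" "NDom \<sigma> = Fn G \<cdot> \<Sigma>" "NCod \<sigma> = \<Sigma> \<cdot> Fn T"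
  using is_nat_in_Arr[OF \<sigma>, of B D] by simp_all

lemmas \<sigma>_simps [simp] = nat_simps[OF \<sigma>_nat(1)]

lemma \<sigma>_natural:
  "f \<in> Arr B \<Longrightarrow> Cod B f = y \<Longrightarrow> Comp D (NAt \<sigma> y) (FArr (Fn G) (FArr \<Sigma> f))
     = Comp D (FArr \<Sigma> (FArr (Fn T) f)) (NAt \<sigma> (Dom B f))"
  using naturality[OF \<sigma>_nat(1), of f y] by simp

lemma \<sigma>_\<delta>:
  "x \<in> Ob B \<Longrightarrow> Comp D (FArr \<Sigma> (NAt (\<delta> T) x)) (NAt \<sigma> x) =
     Comp D (NAt \<sigma> (FOb (Fn T) x)) (Comp D (FArr (Fn G) (NAt \<sigma> x)) (NAt (\<delta> G) (FOb \<Sigma> x)))"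
  using arg_cong[OF \<sigma>_\<delta>_eq, of "\<lambda>\<alpha>. NAt \<alpha> x"] by simp

lemma \<sigma>_\<epsilon>:
  "x \<in> Ob B \<Longrightarrow> Comp D (FArr \<Sigma> (NAt (\<epsilon> T) x)) (NAt \<sigma> x) = NAt (\<epsilon> G) (FOb \<Sigma> x)"
  using arg_cong[OF \<sigma>_\<epsilon>_eq, of "\<lambda>\<alpha>. NAt \<alpha> x"] by simp

abbreviation iter where "iter n \<equiv> iter_l (Fn G) \<Sigma> (Fn T) \<sigma> n"

lemma iter_nat [simp]:
  "iter n \<in> Arr (functor_cat B D)" "NDom (iter n) = Fn G \<up> n \<cdot> \<Sigma>" "NCod (iter n) = \<Sigma> \<cdot> Fn T \<up> n"
  by (induction n) (simp_all add: iter_l.simps(2))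

lemmas iter_simps [simp] = nat_simps[OF iter_nat(1)]

lemma iter_natural:
  "f \<in> Arr B \<Longrightarrow> Cod B f = y \<Longrightarrow> Comp D (NAt (iter n) y) (FArr (Fn G \<up> n) (FArr \<Sigma> f))
     = Comp D (FArr \<Sigma> (FArr (Fn T \<up> n) f)) (NAt (iter n) (Dom B f))"
  using naturality[OF iter_nat(1), of f y] by simp

lemma iter_Suc:
  "x \<in> Ob B \<Longrightarrow> NAt (iter (Suc n)) x =
     Comp D (NAt \<sigma> (FOb (Fn T \<up> n) x)) (FArr (Fn G) (NAt (iter n) x))"
  by (simp add: iter_l.simps(2))

text \<open>The other way to split off one factor. It is needed because \<open>\<rho>\<close> enters the duplicial operator at the
innermost position, whereas the recursion peels off the outermost one.\<close>

lemma iter_Suc':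
  "x \<in> Ob B \<Longrightarrow> NAt (iter (Suc n)) x =
     Comp D (NAt (iter n) (FOb (Fn T) x)) (FArr (Fn G \<up> n) (NAt \<sigma> x))"
proof (induction n)
  case (Suc n)
  then have "NAt (iter (Suc (Suc n))) x = Comp D (NAt \<sigma> (FOb (Fn T \<up> Suc n) x))
      (FArr (Fn G) (Comp D (NAt (iter n) (FOb (Fn T) x)) (FArr (Fn G \<up> n) (NAt \<sigma> x))))"
    using iter_Suc[of x "Suc n"] by simp
  with Suc.prems show ?case by (simp add: iter_Suc[of "FOb (Fn T) x" n])
qed (simp add: iter_Suc)

text \<open>At index \<open>0\<close> the counit axiom of \<open>\<sigma>\<close> consumes the outermost factor of the iterate; at a positive index the
face is \<open>T\<close> of a face, passes this factor by naturality and meets the next one under \<open>G\<close>.\<close>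

lemma iter_face:
  assumes "b \<in> Ob B" "i \<le> n"
  shows "Comp D (FArr \<Sigma> (bar_face T b n i)) (NAt (iter (Suc n)) b) =
    Comp D (NAt (iter n) b) (bar_face G (FOb \<Sigma> b) n i)"
  using assms(2)
proof (induction i arbitrary: n)
  case 0
  with assms(1) show ?case
    by (simp add: iter_Suc src.bar_face_0 tgt.bar_face_0 Comp_tail[OF \<sigma>_\<epsilon>] tgt.\<epsilon>_natural)
next
  case (Suc i)
  then obtain m where [simp]: "n = Suc m" "i \<le> m" by (cases n) auto
  note IH = arg_cong[OF Suc.IH[of m], of "FArr (Fn G)"]
  from IH assms(1) Comp_tail[OF \<sigma>_natural[symmetric, of "bar_face T b m i"]] show ?case
    by (simp add: iter_Suc src.bar_face_Suc tgt.bar_face_Suc)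
qed

text \<open>As for faces, except that at index \<open>0\<close> the comultiplication axiom doubles the outermost factor.\<close>

lemma iter_degen:
  assumes "b \<in> Ob B" "j \<le> n"
  shows "Comp D (FArr \<Sigma> (bar_degen T b n j)) (NAt (iter (Suc n)) b) =
    Comp D (NAt (iter (Suc (Suc n))) b) (bar_degen G (FOb \<Sigma> b) n j)"
  using assms(2)
proof (induction j arbitrary: n)
  case 0
  with assms(1) show ?case
    by (simp add: iter_Suc src.bar_degen_0 tgt.bar_degen_0 Comp_tail[OF \<sigma>_\<delta>] tgt.\<delta>_natural)
next
  case (Suc j)
  then obtain m where [simp]: "n = Suc m" "j \<le> m" by (cases n) auto
  note IH = arg_cong[OF Suc.IH[of m], of "FArr (Fn G)"]
  from IH assms(1) Comp_tail[OF \<sigma>_natural[symmetric, of "bar_degen T b m j"]] show ?case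
    by (simp add: iter_Suc src.bar_degen_Suc tgt.bar_degen_Suc)
qed

end

text \<open>The transformations \<open>\<gamma>: \<Sigma>S \<Rightarrow> C\<Sigma>\<close> and \<open>\<chi>: TS \<Rightarrow> ST\<close> (with \<open>\<Sigma> = T\<close> and \<open>C = S\<close>) are both instances. This is
the mirror image of a morphism under reversal of horizontal composition.\<close>

locale comonad_opmorphism =
  src: comonad_on B S + tgt: comonad_on D C
  for B :: "('o, 'm) cat" and S and D :: "('p, 'n) cat" and C +
  fixes \<Sigma> \<gamma>
  assumes \<Sigma>_functor [simp]: "is_functor \<Sigma> B D"
    and \<gamma>: "is_nat \<gamma> (\<Sigma> \<cdot> Fn S) (Fn C \<cdot> \<Sigma>)"
    and \<gamma>_\<delta>_eq: "(\<delta> C \<lhd> \<Sigma>) \<odot> \<gamma> = (Fn C \<rhd> \<gamma>) \<odot> (\<gamma> \<lhd> Fn S) \<odot> (\<Sigma> \<rhd> \<delta> S)"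
    and \<gamma>_\<epsilon>_eq: "(\<epsilon> C \<lhd> \<Sigma>) \<odot> \<gamma> = \<Sigma> \<rhd> \<epsilon> S"
begin

lemmas \<Sigma>_simps [simp] = functor_simps[OF \<Sigma>_functor]

lemma \<gamma>_nat [simp]:
  "\<gamma> \<in> Arr (functor_cat B D)" "NDom \<gamma> = \<Sigma> \<cdot> Fn S" "NCod \<gamma> = Fn C \<cdot> \<Sigma>"
  using is_nat_in_Arr[OF \<gamma>, of B D] by simp_all

lemmas \<gamma>_simps [simp] = nat_simps[OF \<gamma>_nat(1)]

lemma \<gamma>_natural:
  "f \<in> Arr B \<Longrightarrow> Cod B f = y \<Longrightarrow> Comp D (NAt \<gamma> y) (FArr \<Sigma> (FArr (Fn S) f))
     = Comp D (FArr (Fn C) (FArr \<Sigma> f)) (NAt \<gamma> (Dom B f))"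
  using naturality[OF \<gamma>_nat(1), of f y] by simp

lemma \<gamma>_\<delta>:
  "x \<in> Ob B \<Longrightarrow> Comp D (NAt (\<delta> C) (FOb \<Sigma> x)) (NAt \<gamma> x) =
     Comp D (FArr (Fn C) (NAt \<gamma> x)) (Comp D (NAt \<gamma> (FOb (Fn S) x)) (FArr \<Sigma> (NAt (\<delta> S) x)))"
  using arg_cong[OF \<gamma>_\<delta>_eq, of "\<lambda>\<alpha>. NAt \<alpha> x"] by simp

lemma \<gamma>_\<epsilon>:
  "x \<in> Ob B \<Longrightarrow> Comp D (NAt (\<epsilon> C) (FOb \<Sigma> x)) (NAt \<gamma> x) = FArr \<Sigma> (NAt (\<epsilon> S) x)"
  using arg_cong[OF \<gamma>_\<epsilon>_eq, of "\<lambda>\<alpha>. NAt \<alpha> x"] by simp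

abbreviation iter where "iter n \<equiv> iter_r (Fn S) \<Sigma> (Fn C) \<gamma> n"

lemma iter_nat [simp]:
  "iter n \<in> Arr (functor_cat B D)" "NDom (iter n) = \<Sigma> \<cdot> Fn S \<up> n" "NCod (iter n) = Fn C \<up> n \<cdot> \<Sigma>"
  by (induction n) (simp_all add: iter_r.simps(2))

lemmas iter_simps [simp] = nat_simps[OF iter_nat(1)]

lemma iter_natural:
  "f \<in> Arr B \<Longrightarrow> Cod B f = y \<Longrightarrow> Comp D (NAt (iter n) y) (FArr \<Sigma> (FArr (Fn S \<up> n) f))
     = Comp D (FArr (Fn C \<up> n) (FArr \<Sigma> f)) (NAt (iter n) (Dom B f))"
  using naturality[OF iter_nat(1), of f y] by simp

lemma iter_Suc:
  "x \<in> Ob B \<Longrightarrow> NAt (iter (Suc n)) x =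
     Comp D (FArr (Fn C) (NAt (iter n) x)) (NAt \<gamma> (FOb (Fn S \<up> n) x))"
  by (simp add: iter_r.simps(2))

lemma iter_Suc':
  "x \<in> Ob B \<Longrightarrow> NAt (iter (Suc n)) x =
     Comp D (FArr (Fn C \<up> n) (NAt \<gamma> x)) (NAt (iter n) (FOb (Fn S) x))"
proof (induction n)
  case (Suc n)
  then have "NAt (iter (Suc (Suc n))) x =
      Comp D (FArr (Fn C) (Comp D (FArr (Fn C \<up> n) (NAt \<gamma> x)) (NAt (iter n) (FOb (Fn S) x))))
        (NAt \<gamma> (FOb (Fn S \<up> Suc n) x))"
    using iter_Suc[of x "Suc n"] by simp
  with Suc.prems show ?case by (simp add: iter_Suc[of "FOb (Fn S) x" n])
qed (simp add: iter_Suc)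

lemma iter_face:
  assumes "b \<in> Ob B" "i \<le> n"
  shows "Comp D (bar_face C (FOb \<Sigma> b) n i) (NAt (iter (Suc n)) b) =
    Comp D (NAt (iter n) b) (FArr \<Sigma> (bar_face S b n i))"
  using assms(2)
proof (induction i arbitrary: n)
  case 0
  with assms(1) show ?case
    by (simp add: iter_Suc src.bar_face_0 tgt.bar_face_0 \<gamma>_\<epsilon> Comp_tail[OF tgt.\<epsilon>_natural])
next
  case (Suc i)
  then obtain m where [simp]: "n = Suc m" "i \<le> m" by (cases n) auto
  note IH = arg_cong[OF Suc.IH[OF \<open>i \<le> m\<close>], of "FArr (Fn C)"]
  have "Comp D (bar_face C (FOb \<Sigma> b) n (Suc i)) (NAt (iter (Suc n)) b) =
    Comp D (FArr (Fn C) (Comp D (bar_face C (FOb \<Sigma> b) m i) (NAt (iter (Suc m)) b)))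
      (NAt \<gamma> (FOb (Fn S \<up> Suc m) b))"
    using assms(1) by (simp add: iter_Suc[of _ "Suc m"] tgt.bar_face_Suc)
  also have "\<dots> = Comp D (NAt (iter n) b) (FArr \<Sigma> (bar_face S b n (Suc i)))"
    using assms(1) \<gamma>_natural[symmetric, of "bar_face S b m i"]
    by (simp only: IH) (simp add: iter_Suc[of _ m] src.bar_face_Suc)
  finally show ?case .
qed

lemma iter_degen:
  assumes "b \<in> Ob B" "j \<le> n"
  shows "Comp D (bar_degen C (FOb \<Sigma> b) n j) (NAt (iter (Suc n)) b) =
    Comp D (NAt (iter (Suc (Suc n))) b) (FArr \<Sigma> (bar_degen S b n j))"
  using assms(2)
proof (induction j arbitrary: n)
  case 0
  with assms(1) show ?case
    by (simp add: iter_Suc src.bar_degen_0 tgt.bar_degen_0 \<gamma>_\<delta> Comp_tail[OF tgt.\<delta>_natural])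
next
  case (Suc j)
  then obtain m where [simp]: "n = Suc m" "j \<le> m" by (cases n) auto
  note IH = arg_cong[OF Suc.IH[OF \<open>j \<le> m\<close>], of "FArr (Fn C)"]
  have "Comp D (bar_degen C (FOb \<Sigma> b) n (Suc j)) (NAt (iter (Suc n)) b) =
    Comp D (FArr (Fn C) (Comp D (bar_degen C (FOb \<Sigma> b) m j) (NAt (iter (Suc m)) b)))
      (NAt \<gamma> (FOb (Fn S \<up> Suc m) b))"
    using assms(1) by (simp add: iter_Suc[of _ "Suc m"] tgt.bar_degen_Suc)
  also have "\<dots> = Comp D (NAt (iter (Suc (Suc n))) b) (FArr \<Sigma> (bar_degen S b n (Suc j)))"
    using assms(1) \<gamma>_natural[symmetric, of "bar_degen S b m j"]
    by (simp only: IH) (simp add: iter_Suc[of _ "Suc (Suc m)"] src.bar_degen_Suc)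
  finally show ?case .
qed

end

section \<open>Distributive laws\<close>

locale distributive = T: comonad_on B T + S: comonad_on B S
  for B :: "('o, 'm) cat" and T S +
  fixes \<chi>
  assumes dist_law: "dist_law B \<chi> T S"
begin

sublocale \<chi>T: comonad_morphism B T B T "Fn S" \<chi>
  by unfold_locales (use dist_law in \<open>auto simp: dist_law_def\<close>)

sublocale \<chi>S: comonad_opmorphism B S B S "Fn T" \<chi>
  by unfold_locales (use dist_law in \<open>auto simp: dist_law_def\<close>)

text \<open>The structure of the other comonad also passes the iterates: \<open>\<chi>\<^sup>n: T\<^sup>nS \<Rightarrow> ST\<^sup>n\<close> makes \<open>T\<^sup>n\<close> an opmorphism from
\<open>S\<close> to \<open>S\<close>, and \<open>\<chi>\<^sup>n: TS\<^sup>n \<Rightarrow> S\<^sup>nT\<close> makes \<open>S\<^sup>n\<close> a morphism from \<open>T\<close> to \<open>T\<close>.\<close>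

lemma \<chi>T_counit:
  assumes "x \<in> Ob B"
  shows "Comp B (NAt (\<epsilon> S) (FOb (Fn T \<up> n) x)) (NAt (\<chi>T.iter n) x) = FArr (Fn T \<up> n) (NAt (\<epsilon> S) x)"
proof (induction n)
  case (Suc n)
  from arg_cong[OF Suc, of "FArr (Fn T)"] assms show ?case
    by (simp add: \<chi>T.iter_Suc Comp_tail[OF \<chi>S.\<gamma>_\<epsilon>])
qed (use assms in simp)

lemma \<chi>T_comult:
  assumes "x \<in> Ob B"
  shows "Comp B (NAt (\<delta> S) (FOb (Fn T \<up> n) x)) (NAt (\<chi>T.iter n) x) =
    Comp B (FArr (Fn S) (NAt (\<chi>T.iter n) x)) (Comp B (NAt (\<chi>T.iter n) (FOb (Fn S) x))
      (FArr (Fn T \<up> n) (NAt (\<delta> S) x)))"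
proof (induction n)
  case (Suc n)
  from arg_cong[OF Suc, of "FArr (Fn T)"] assms show ?case
    by (simp add: \<chi>T.iter_Suc Comp_tail[OF \<chi>S.\<gamma>_\<delta>] Comp_tail[OF \<chi>S.\<gamma>_natural])
qed (use assms in simp)

lemma \<chi>S_counit:
  assumes "x \<in> Ob B"
  shows "Comp B (FArr (Fn S \<up> n) (NAt (\<epsilon> T) x)) (NAt (\<chi>S.iter n) x) = NAt (\<epsilon> T) (FOb (Fn S \<up> n) x)"
proof (induction n)
  case (Suc n)
  have "Comp B (FArr (Fn S \<up> Suc n) (NAt (\<epsilon> T) x)) (NAt (\<chi>S.iter (Suc n)) x) =
    Comp B (FArr (Fn S) (Comp B (FArr (Fn S \<up> n) (NAt (\<epsilon> T) x)) (NAt (\<chi>S.iter n) x)))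
      (NAt \<chi> (FOb (Fn S \<up> n) x))"
    using assms by (simp add: \<chi>S.iter_Suc)
  also have "\<dots> = NAt (\<epsilon> T) (FOb (Fn S \<up> Suc n) x)"
    using assms by (simp only: Suc) (simp add: \<chi>T.\<sigma>_\<epsilon>)
  finally show ?case .
qed (use assms in simp)

lemma \<chi>S_comult:
  assumes "x \<in> Ob B"
  shows "Comp B (FArr (Fn S \<up> n) (NAt (\<delta> T) x)) (NAt (\<chi>S.iter n) x) =
    Comp B (NAt (\<chi>S.iter n) (FOb (Fn T) x)) (Comp B (FArr (Fn T) (NAt (\<chi>S.iter n) x))
      (NAt (\<delta> T) (FOb (Fn S \<up> n) x)))"
proof (induction n)
  case (Suc n)
  have "Comp B (FArr (Fn S \<up> Suc n) (NAt (\<delta> T) x)) (NAt (\<chi>S.iter (Suc n)) x) =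
    Comp B (FArr (Fn S) (Comp B (FArr (Fn S \<up> n) (NAt (\<delta> T) x)) (NAt (\<chi>S.iter n) x)))
      (NAt \<chi> (FOb (Fn S \<up> n) x))"
    using assms by (simp add: \<chi>S.iter_Suc)
  also have "\<dots> = Comp B (NAt (\<chi>S.iter (Suc n)) (FOb (Fn T) x))
      (Comp B (FArr (Fn T) (NAt (\<chi>S.iter (Suc n)) x)) (NAt (\<delta> T) (FOb (Fn S \<up> Suc n) x)))"
    using assms Comp_tail[OF \<chi>T.\<sigma>_natural[symmetric, of "NAt (\<chi>S.iter n) x"]]
    by (simp only: Suc) (simp add: \<chi>T.\<sigma>_\<delta> \<chi>S.iter_Suc)
  finally show ?case .
qed (use assms in simp)

end

section \<open>Coalgebras and opcoalgebras of a distributive law\<close>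

locale coalgebra = distributive B T S \<chi>
  for B :: "('o, 'm) cat" and T S \<chi> +
  fixes X :: "('p, 'n) cat" and M \<rho>
  assumes M_functor [simp]: "is_functor M X B" and coalgebra: "coalgebra_str \<chi> T S M \<rho>"
begin

lemmas M_simps [simp] = functor_simps[OF M_functor]

lemma \<rho>_nat [simp]:
  "\<rho> \<in> Arr (functor_cat X B)" "NDom \<rho> = Fn T \<cdot> M" "NCod \<rho> = Fn S \<cdot> M"
  using coalgebra is_nat_in_Arr[of \<rho> "Fn T \<cdot> M" "Fn S \<cdot> M" X B] by (simp_all add: coalgebra_str_def)

lemmas \<rho>_simps [simp] = nat_simps[OF \<rho>_nat(1)]

lemma \<rho>_\<delta>:
  assumes "x \<in> Ob X"
  shows "Comp B (NAt (\<delta> S) (FOb M x)) (NAt \<rho> x) = Comp B (FArr (Fn S) (NAt \<rho> x))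
    (Comp B (NAt \<chi> (FOb M x)) (Comp B (FArr (Fn T) (NAt \<rho> x)) (NAt (\<delta> T) (FOb M x))))"
proof -
  have "(\<delta> S \<lhd> M) \<odot> \<rho> = (Fn S \<rhd> \<rho>) \<odot> (\<chi> \<lhd> M) \<odot> (Fn T \<rhd> \<rho>) \<odot> (\<delta> T \<lhd> M)"
    using coalgebra by (simp add: coalgebra_str_def)
  from arg_cong[OF this, of "\<lambda>\<alpha>. NAt \<alpha> x"] assms show ?thesis by simp
qed

lemma \<rho>_\<epsilon>:
  assumes "x \<in> Ob X"
  shows "Comp B (NAt (\<epsilon> S) (FOb M x)) (NAt \<rho> x) = NAt (\<epsilon> T) (FOb M x)"
proof -
  have "(\<epsilon> S \<lhd> M) \<odot> \<rho> = \<epsilon> T \<lhd> M"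
    using coalgebra by (simp add: coalgebra_str_def)
  from arg_cong[OF this, of "\<lambda>\<alpha>. NAt \<alpha> x"] assms show ?thesis by simp
qed

text \<open>The component at \<open>x\<close> of the arrow \<open>T T\<^sup>nM \<Rightarrow> S T\<^sup>nM\<close> that carries the operator \<open>t\<^sub>T\<close>.\<close>

definition coalg_T :: "nat \<Rightarrow> 'p \<Rightarrow> 'm" where
  "coalg_T n x = Comp B (NAt (\<chi>T.iter n) (FOb M x)) (FArr (Fn T \<up> n) (NAt \<rho> x))"

lemma coalg_T_simps [simp]:
  assumes "x \<in> Ob X"
  shows "coalg_T n x \<in> Arr B" "Dom B (coalg_T n x) = FOb (Fn T) (FOb (Fn T \<up> n) (FOb M x))"
    "Cod B (coalg_T n x) = FOb (Fn S) (FOb (Fn T \<up> n) (FOb M x))"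
  using assms by (simp_all add: coalg_T_def)

lemma coalg_T_Suc:
  assumes "x \<in> Ob X"
  shows "coalg_T (Suc n) x = Comp B (NAt \<chi> (FOb (Fn T \<up> n) (FOb M x))) (FArr (Fn T) (coalg_T n x))"
  using assms by (simp add: coalg_T_def \<chi>T.iter_Suc)

text \<open>The inner face or degeneracy first crosses \<open>\<chi>\<^sup>n\<close>, landing at the object \<open>S M x\<close>, and then crosses \<open>T\<^sup>n\<rho>\<close>
because faces and degeneracies are natural in the object.\<close>

lemma coalg_T_face:
  assumes "x \<in> Ob X" "i \<le> n"
  shows "Comp B (FArr (Fn S) (bar_face T (FOb M x) n i)) (coalg_T (Suc n) x) =
    Comp B (coalg_T n x) (bar_face T (FOb M x) (Suc n) i)"
  using assms T.bar_face_natural[of "NAt \<rho> x" i n]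
  by (simp add: coalg_T_def Comp_tail[OF \<chi>T.iter_face] T.bar_face_shift)

lemma coalg_T_degen:
  assumes "x \<in> Ob X" "j \<le> n"
  shows "Comp B (FArr (Fn S) (bar_degen T (FOb M x) n j)) (coalg_T (Suc n) x) =
    Comp B (coalg_T (Suc (Suc n)) x) (bar_degen T (FOb M x) (Suc n) j)"
  using assms T.bar_degen_natural[of "NAt \<rho> x" j n]
  by (simp add: coalg_T_def Comp_tail[OF \<chi>T.iter_degen] T.bar_degen_shift)

lemma coalg_T_counit:
  assumes "x \<in> Ob X"
  shows "Comp B (NAt (\<epsilon> S) (FOb (Fn T \<up> n) (FOb M x))) (coalg_T n x) = bar_face T (FOb M x) n n"
  using assms arg_cong[OF \<rho>_\<epsilon>[OF assms], of "FArr (Fn T \<up> n)"]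
  by (simp add: coalg_T_def Comp_tail[OF \<chi>T_counit] T.bar_face_last)

text \<open>This is the source of the square in \<open>s\<^sub>0t = t\<^sup>2s\<^sub>n\<close>: \<open>\<delta>\<^sub>S\<close> splits \<open>\<chi>\<^sup>n\<close> into two copies, the coalgebra axiom splits
\<open>\<rho>\<close> into two copies with a \<open>\<chi>\<close> in between, and naturality of \<open>\<chi>\<^sup>n\<close> sorts the factors into two
successive arrows. The \<open>\<chi>\<close> in between extends the one applied first from \<open>n\<close> to \<open>n + 1\<close>.\<close>

lemma coalg_T_comult:
  assumes "x \<in> Ob X"
  shows "Comp B (NAt (\<delta> S) (FOb (Fn T \<up> n) (FOb M x))) (coalg_T n x) =
    Comp B (FArr (Fn S) (coalg_T n x)) (Comp B (coalg_T (Suc n) x) (bar_degen T (FOb M x) n n))"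
  using assms arg_cong[OF \<rho>_\<delta>[OF assms], of "FArr (Fn T \<up> n)"]
  by (simp add: coalg_T_def Comp_tail[OF \<chi>T_comult] T.bar_degen_last \<chi>T.iter_Suc'
      Comp_tail[OF \<chi>T.iter_natural])

text \<open>The counterpart for \<open>t\<^sub>S\<close>: an arrow \<open>T S\<^sup>nM \<Rightarrow> S S\<^sup>nM\<close>, here applied after the opcoalgebra structure instead of before
it. The properties below mirror those of \<open>coalg_T\<close> under reversal of horizontal composition, which interchanges the two
comonads.\<close>

definition coalg_S :: "nat \<Rightarrow> 'p \<Rightarrow> 'm" where
  "coalg_S n x = Comp B (FArr (Fn S \<up> n) (NAt \<rho> x)) (NAt (\<chi>S.iter n) (FOb M x))"

lemma coalg_S_simps [simp]:
  assumes "x \<in> Ob X"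
  shows "coalg_S n x \<in> Arr B" "Dom B (coalg_S n x) = FOb (Fn T) (FOb (Fn S \<up> n) (FOb M x))"
    "Cod B (coalg_S n x) = FOb (Fn S) (FOb (Fn S \<up> n) (FOb M x))"
  using assms by (simp_all add: coalg_S_def)

lemma coalg_S_Suc:
  assumes "x \<in> Ob X"
  shows "coalg_S (Suc n) x = Comp B (FArr (Fn S) (coalg_S n x)) (NAt \<chi> (FOb (Fn S \<up> n) (FOb M x)))"
  using assms by (simp add: coalg_S_def \<chi>S.iter_Suc)

lemma coalg_S_face:
  assumes "x \<in> Ob X" "i \<le> n"
  shows "Comp B (bar_face S (FOb M x) (Suc n) i) (coalg_S (Suc n) x) =
    Comp B (coalg_S n x) (FArr (Fn T) (bar_face S (FOb M x) n i))"
  using assms Comp_tail[OF S.bar_face_natural[of "NAt \<rho> x" i n]]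
  by (simp add: coalg_S_def \<chi>S.iter_face flip: S.bar_face_shift)

lemma coalg_S_degen:
  assumes "x \<in> Ob X" "j \<le> n"
  shows "Comp B (bar_degen S (FOb M x) (Suc n) j) (coalg_S (Suc n) x) =
    Comp B (coalg_S (Suc (Suc n)) x) (FArr (Fn T) (bar_degen S (FOb M x) n j))"
  using assms Comp_tail[OF S.bar_degen_natural[of "NAt \<rho> x" j n]]
  by (simp add: coalg_S_def \<chi>S.iter_degen flip: S.bar_degen_shift)

lemma coalg_S_counit:
  assumes "x \<in> Ob X"
  shows "Comp B (bar_face S (FOb M x) n n) (coalg_S n x) = NAt (\<epsilon> T) (FOb (Fn S \<up> n) (FOb M x))"
proof -
  have "Comp B (bar_face S (FOb M x) n n) (coalg_S n x) =
    Comp B (FArr (Fn S \<up> n) (Comp B (NAt (\<epsilon> S) (FOb M x)) (NAt \<rho> x))) (NAt (\<chi>S.iter n) (FOb M x))"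
    using assms by (simp add: coalg_S_def S.bar_face_last)
  then show ?thesis using assms by (simp add: \<rho>_\<epsilon> \<chi>S_counit)
qed

lemma coalg_S_comult:
  assumes "x \<in> Ob X"
  shows "Comp B (bar_degen S (FOb M x) n n) (coalg_S n x) =
    Comp B (coalg_S (Suc n) x)
      (Comp B (FArr (Fn T) (coalg_S n x)) (NAt (\<delta> T) (FOb (Fn S \<up> n) (FOb M x))))"
proof -
  have "Comp B (bar_degen S (FOb M x) n n) (coalg_S n x) =
    Comp B (FArr (Fn S \<up> n) (Comp B (NAt (\<delta> S) (FOb M x)) (NAt \<rho> x))) (NAt (\<chi>S.iter n) (FOb M x))"
    using assms by (simp add: coalg_S_def S.bar_degen_last)
  also have "\<dots> = Comp B (coalg_S (Suc n) x)
      (Comp B (FArr (Fn T) (coalg_S n x)) (NAt (\<delta> T) (FOb (Fn S \<up> n) (FOb M x))))"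
    using assms Comp_tail[OF \<chi>S.iter_natural[symmetric, of "NAt \<rho> x"]]
    by (simp add: \<rho>_\<delta> coalg_S_def \<chi>S_comult \<chi>S.iter_Suc')
  finally show ?thesis .
qed

end

locale opcoalgebra = distributive B T S \<chi>
  for B :: "('o, 'm) cat" and T S \<chi> +
  fixes Y :: "('q, 'k) cat" and N l
  assumes N_functor [simp]: "is_functor N B Y" and opcoalgebra: "opcoalgebra_str \<chi> T S N l"
begin

lemmas N_simps [simp] = functor_simps[OF N_functor]

lemma l_nat [simp]:
  "l \<in> Arr (functor_cat B Y)" "NDom l = N \<cdot> Fn S" "NCod l = N \<cdot> Fn T"
  using opcoalgebra is_nat_in_Arr[of l "N \<cdot> Fn S" "N \<cdot> Fn T" B Y] by (simp_all add: opcoalgebra_str_def)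

lemmas l_simps [simp] = nat_simps[OF l_nat(1)]

lemma l_natural:
  "f \<in> Arr B \<Longrightarrow> Cod B f = y \<Longrightarrow> Comp Y (NAt l y) (FArr N (FArr (Fn S) f))
     = Comp Y (FArr N (FArr (Fn T) f)) (NAt l (Dom B f))"
  using naturality[OF l_nat(1), of f y] by simp

lemma l_\<delta>:
  assumes "x \<in> Ob B"
  shows "Comp Y (FArr N (NAt (\<delta> T) x)) (NAt l x) = Comp Y (NAt l (FOb (Fn T) x))
    (Comp Y (FArr N (NAt \<chi> x)) (Comp Y (NAt l (FOb (Fn S) x)) (FArr N (NAt (\<delta> S) x))))"
proof -
  have "(N \<rhd> \<delta> T) \<odot> l = (l \<lhd> Fn T) \<odot> (N \<rhd> \<chi>) \<odot> (l \<lhd> Fn S) \<odot> (N \<rhd> \<delta> S)"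
    using opcoalgebra by (simp add: opcoalgebra_str_def)
  from arg_cong[OF this, of "\<lambda>\<alpha>. NAt \<alpha> x"] assms show ?thesis by simp
qed

lemma l_\<epsilon>:
  assumes "x \<in> Ob B"
  shows "Comp Y (FArr N (NAt (\<epsilon> T) x)) (NAt l x) = FArr N (NAt (\<epsilon> S) x)"
proof -
  have "(N \<rhd> \<epsilon> T) \<odot> l = N \<rhd> \<epsilon> S"
    using opcoalgebra by (simp add: opcoalgebra_str_def)
  from arg_cong[OF this, of "\<lambda>\<alpha>. NAt \<alpha> x"] assms show ?thesis by simp
qed

end

section \<open>The duplicial objects of a coalgebra and an opcoalgebra\<close>

locale coalgebra_pair = coalgebra B T S \<chi> X M \<rho> + opcoalgebra B T S \<chi> Y N l
  for B :: "('o, 'm) cat" and T S \<chi> and X :: "('p, 'n) cat" and M \<rho> and Y :: "('q, 'k) cat" and N l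
begin

lemma bar_dup_at:
  assumes "x \<in> Ob X"
  shows "FOb (obj (bar_dup \<chi> T S N l M \<rho>) n) x = FOb N (FOb (Fn T) (FOb (Fn T \<up> n) (FOb M x)))"
    and "NAt (face (bar_dup \<chi> T S N l M \<rho>) n i) x = FArr N (bar_face T (FOb M x) n i)"
    and "NAt (degen (bar_dup \<chi> T S N l M \<rho>) n i) x = FArr N (bar_degen T (FOb M x) n i)"
    and "NAt (tt (bar_dup \<chi> T S N l M \<rho>) n) x =
      Comp Y (NAt l (FOb (Fn T \<up> n) (FOb M x))) (FArr N (coalg_T n x))"
  using assms by (simp_all add: bar_dup_def bar_face_def bar_degen_def coalg_T_def)

lemma bar_op_dup_at:
  assumes "x \<in> Ob X"
  shows "FOb (obj (bar_op_dup \<chi> T S N l M \<rho>) n) x = FOb N (FOb (Fn S) (FOb (Fn S \<up> n) (FOb M x)))"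
    and "i \<le> n \<Longrightarrow>
      NAt (face (bar_op_dup \<chi> T S N l M \<rho>) n i) x = FArr N (bar_face S (FOb M x) n (n - i))"
    and "i \<le> n \<Longrightarrow>
      NAt (degen (bar_op_dup \<chi> T S N l M \<rho>) n i) x = FArr N (bar_degen S (FOb M x) n (n - i))"
    and "NAt (tt (bar_op_dup \<chi> T S N l M \<rho>) n) x =
      Comp Y (FArr N (coalg_S n x)) (NAt l (FOb (Fn S \<up> n) (FOb M x)))"
  using assms by (simp_all add: bar_op_dup_def bar_face_def bar_degen_def coalg_S_def)

text \<open>The opcoalgebra structure handles what is outermost. A face or degeneracy of positive index is \<open>T\<close> of another
one, so it crosses \<open>l\<close> by naturality and then the arrow below; at index \<open>0\<close> the axioms of \<open>l\<close> trade
\<open>\<epsilon>\<^sub>T\<close> for \<open>\<epsilon>\<^sub>S\<close> and \<open>\<delta>\<^sub>T\<close> for \<open>\<delta>\<^sub>S\<close>, to which \<open>coalg_T_counit\<close> and \<open>coalg_T_comult\<close> apply.\<close>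

lemma duplicial_bar_at:
  assumes x: "x \<in> Ob X"
  shows "duplicial Y (eval_at x (bar_dup \<chi> T S N l M \<rho>))"
proof -
  let ?b = "FOb M x" and ?Z = "eval_at x (bar_dup \<chi> T S N l M \<rho>)"
  note [simp] = bar_dup_at[OF x]
  have simplicial: "simplicial Y ?Z"
    by (rule simplicial_cong[OF simplicial_map[OF T.simplicial_bar_at[of ?b] N_functor]])
      (use x in \<open>simp_all add: map_simp_obj_def\<close>)
  show ?thesis
    unfolding duplicial_def
  proof (intro conjI allI impI, goal_cases)
    case (3 n i)
    then obtain m k where [simp]: "n = Suc m" "i = Suc k" "k \<le> m" "k \<le> Suc m" by (cases n; cases i) auto
    from x arg_cong[OF coalg_T_face[of x k m], of "FArr N"]
      Comp_tail[OF l_natural[symmetric, of "bar_face T ?b m k"]]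
    show ?case by (simp add: T.bar_face_Suc)
  next
    case (4 n)
    from x arg_cong[OF coalg_T_counit[of x n], of "FArr N"]
    show ?case by (simp add: T.bar_face_0 Comp_tail[OF l_\<epsilon>])
  next
    case (5 n j)
    then obtain m k where [simp]: "n = Suc m" "j = Suc k" "k \<le> m" "k \<le> Suc m" by (cases n; cases j) auto
    from x arg_cong[OF coalg_T_degen[of x k m], of "FArr N"]
      Comp_tail[OF l_natural[symmetric, of "bar_degen T ?b m k"]]
    show ?case by (simp add: T.bar_degen_Suc)
  next
    case (6 n)
    from x arg_cong[OF coalg_T_comult[of x n], of "FArr N"]
    show ?case
      by (simp add: T.bar_degen_0 Comp_tail[OF l_\<delta>] coalg_T_Suc Comp_tail[OF l_natural]
         )
  qed (use x simplicial in \<open>simp_all add: arrow_iff\<close>)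
qed

text \<open>Since indices are reversed, the face of index \<open>i > 0\<close> is an inner face of \<open>S\<close>, of index \<open>k = n - i\<close>, which meets
the \<open>S\<^sup>n\<rho>\<close> side first; after passing it lies under \<open>T\<close>, and \<open>l\<close> moves it to index \<open>k + 1\<close>.\<close>

lemma duplicial_bar_op_at:
  assumes x: "x \<in> Ob X"
  shows "duplicial Y (eval_at x (bar_op_dup \<chi> T S N l M \<rho>))"
proof -
  let ?b = "FOb M x" and ?Z = "eval_at x (bar_op_dup \<chi> T S N l M \<rho>)"
  note [simp] = bar_op_dup_at[OF x]
  have simplicial: "simplicial Y ?Z"
    by (rule simplicial_cong[OF simplicial_map[OF
            simplicial_opposite[OF S.simplicial_bar_at[of ?b]] N_functor]])
      (use x in \<open>simp_all add: map_simp_obj_def opposite_simp_obj_def\<close>)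
  show ?thesis
    unfolding duplicial_def
  proof (intro conjI allI impI, goal_cases)
    case (3 n i)
    then obtain m where [simp]: "n = Suc m" by (cases n) auto
    define k where "k = n - i"
    with 3 have [simp]: "k \<le> m" "k \<le> Suc m" "Suc m - i = k" "Suc m - (i - Suc 0) = Suc k" "i - Suc 0 \<le> Suc m" by auto
    from x 3 Comp_tail[OF functor_Comp_eq[OF coalg_S_face[of x k m] N_functor]]
      l_natural[symmetric, of "bar_face S ?b m k"]
    show ?case by (simp add: S.bar_face_Suc)
  next
    case (4 n)
    from x Comp_tail[OF functor_Comp_eq[OF coalg_S_counit[of x n] N_functor]]
    show ?case by (simp add: S.bar_face_0 l_\<epsilon>)
  next
    case (5 n j)
    then obtain m where [simp]: "n = Suc m" by (cases n) auto
    define k where "k = n - j"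
    with 5 have [simp]: "k \<le> m" "Suc m - j = k" "Suc m - (j - Suc 0) = Suc k" "j - Suc 0 \<le> Suc m"
      "k \<le> Suc m" by auto
    from x 5 Comp_tail[OF functor_Comp_eq[OF coalg_S_degen[of x k m] N_functor]]
      l_natural[symmetric, of "bar_degen S ?b m k"]
    show ?case by (simp add: S.bar_degen_Suc)
  next
    case (6 n)
    from x Comp_tail[OF functor_Comp_eq[OF coalg_S_comult[of x n] N_functor]]
      Comp_tail[OF l_natural[symmetric, of "coalg_S n x"]]
    show ?case
      by (simp add: S.bar_degen_0 l_\<delta> coalg_S_Suc[of x n])
  qed (use x simplicial in \<open>simp_all add: arrow_iff\<close>)
qed

lemma duplicial_bar: "duplicial (functor_cat X Y) (bar_dup \<chi> T S N l M \<rho>)"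
proof -
  interpret pointwise_duplicial X Y "bar_dup \<chi> T S N l M \<rho>"
    by unfold_locales (simp_all add: duplicial_bar_at, simp_all add: bar_dup_def functor_cat_arrow)
  show ?thesis by (rule duplicial)
qed

lemma duplicial_bar_op: "duplicial (functor_cat X Y) (bar_op_dup \<chi> T S N l M \<rho>)"
proof -
  interpret pointwise_duplicial X Y "bar_op_dup \<chi> T S N l M \<rho>"
    by unfold_locales (simp_all add: duplicial_bar_op_at, simp_all add: bar_op_dup_def functor_cat_arrow)
  show ?thesis by (rule duplicial)
qed

end

section \<open>Transport along a 1-cell\<close>

locale one_cell = src: distributive B T S \<chi> + tgt: distributive D G C \<tau>
  for B :: "('o, 'm) cat" and T S \<chi> and D :: "('p, 'n) cat" and G C \<tau> +
  fixes \<Sigma> \<sigma> \<gamma>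
  assumes one_cell: "dist_1cell B \<chi> T S D \<tau> G C \<Sigma> \<sigma> \<gamma>"
begin

sublocale \<Sigma>\<sigma>: comonad_morphism B T D G \<Sigma> \<sigma>
  by unfold_locales (use one_cell in \<open>auto simp: dist_1cell_def\<close>)

sublocale \<Sigma>\<gamma>: comonad_opmorphism B S D C \<Sigma> \<gamma>
  by unfold_locales (use one_cell in \<open>auto simp: dist_1cell_def\<close>)

text \<open>The six factors are the two ways of turning the word \<open>G\<Sigma>S\<close> into \<open>C\<Sigma>T\<close>.\<close>

lemma hexagon:
  assumes "x \<in> Ob B"
  shows "Comp D (NAt \<gamma> (FOb (Fn T) x)) (Comp D (FArr \<Sigma> (NAt \<chi> x)) (NAt \<sigma> (FOb (Fn S) x))) =
    Comp D (FArr (Fn C) (NAt \<sigma> x)) (Comp D (NAt \<tau> (FOb \<Sigma> x)) (FArr (Fn G) (NAt \<gamma> x)))"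
proof -
  have "(\<gamma> \<lhd> Fn T) \<odot> (\<Sigma> \<rhd> \<chi>) \<odot> (\<sigma> \<lhd> Fn S) = (Fn C \<rhd> \<sigma>) \<odot> (\<tau> \<lhd> \<Sigma>) \<odot> (Fn G \<rhd> \<gamma>)"
    using one_cell by (simp add: dist_1cell_def)
  from arg_cong[OF this, of "\<lambda>\<alpha>. NAt \<alpha> x"] assms show ?thesis by simp
qed

text \<open>Each induction step inserts one more hexagon at the outermost position; the previous iterates are first
moved past \<open>\<sigma>\<close> or \<open>\<tau>\<close> by naturality.\<close>

lemma hexagon_\<sigma>_iter:
  assumes "x \<in> Ob B"
  shows "Comp D (NAt \<gamma> (FOb (Fn T \<up> n) x))
      (Comp D (FArr \<Sigma> (NAt (src.\<chi>T.iter n) x)) (NAt (\<Sigma>\<sigma>.iter n) (FOb (Fn S) x))) =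
    Comp D (FArr (Fn C) (NAt (\<Sigma>\<sigma>.iter n) x))
      (Comp D (NAt (tgt.\<chi>T.iter n) (FOb \<Sigma> x)) (FArr (Fn G \<up> n) (NAt \<gamma> x)))"
proof (induction n)
  case (Suc n)
  from assms arg_cong[OF Suc, of "FArr (Fn G)"]
    Comp_tail[OF \<Sigma>\<sigma>.\<sigma>_natural[symmetric, of "NAt (src.\<chi>T.iter n) x"]]
  show ?case
    by (simp add: src.\<chi>T.iter_Suc tgt.\<chi>T.iter_Suc \<Sigma>\<sigma>.iter_Suc
        Comp_tail3[OF hexagon] Comp_tail[OF tgt.\<chi>T.\<sigma>_natural])
qed (use assms in simp)

lemma hexagon_\<gamma>_iter:
  assumes "x \<in> Ob B"
  shows "Comp D (NAt (\<Sigma>\<gamma>.iter n) (FOb (Fn T) x))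
      (Comp D (FArr \<Sigma> (NAt (src.\<chi>S.iter n) x)) (NAt \<sigma> (FOb (Fn S \<up> n) x))) =
    Comp D (FArr (Fn C \<up> n) (NAt \<sigma> x))
      (Comp D (NAt (tgt.\<chi>S.iter n) (FOb \<Sigma> x)) (FArr (Fn G) (NAt (\<Sigma>\<gamma>.iter n) x)))"
proof (induction n)
  case (Suc n)
  let ?y = "FOb (Fn S \<up> n) x"
  have "Comp D (NAt (\<Sigma>\<gamma>.iter (Suc n)) (FOb (Fn T) x))
      (Comp D (FArr \<Sigma> (NAt (src.\<chi>S.iter (Suc n)) x)) (NAt \<sigma> (FOb (Fn S \<up> Suc n) x))) =
    Comp D (FArr (Fn C) (Comp D (NAt (\<Sigma>\<gamma>.iter n) (FOb (Fn T) x))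
        (Comp D (FArr \<Sigma> (NAt (src.\<chi>S.iter n) x)) (NAt \<sigma> ?y))))
      (Comp D (NAt \<tau> (FOb \<Sigma> ?y)) (FArr (Fn G) (NAt \<gamma> ?y)))"
    using assms Comp_tail[OF \<Sigma>\<gamma>.\<gamma>_natural[of "NAt (src.\<chi>S.iter n) x"]]
    by (simp add: src.\<chi>S.iter_Suc \<Sigma>\<gamma>.iter_Suc hexagon)
  also have "\<dots> = Comp D (FArr (Fn C \<up> Suc n) (NAt \<sigma> x))
      (Comp D (NAt (tgt.\<chi>S.iter (Suc n)) (FOb \<Sigma> x)) (FArr (Fn G) (NAt (\<Sigma>\<gamma>.iter (Suc n)) x)))"
    using assms Comp_tail[OF tgt.\<chi>T.\<sigma>_natural[of "NAt (\<Sigma>\<gamma>.iter n) x"]]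
    by (simp only: Suc) (simp add: tgt.\<chi>S.iter_Suc \<Sigma>\<gamma>.iter_Suc)
  finally show ?case .
qed (use assms in simp)

end

locale coalgebra_1cell = one_cell B T S \<chi> D G C \<tau> \<Sigma> \<sigma> \<gamma> + srcM: coalgebra B T S \<chi> X M \<rho>
  for B :: "('o, 'm) cat" and T S \<chi> and D :: "('p, 'n) cat" and G C \<tau> \<Sigma> \<sigma> \<gamma>
    and X :: "('q, 'k) cat" and M \<rho>
begin

abbreviation push where "push \<equiv> push_coalgebra \<Sigma> \<sigma> \<gamma> M \<rho>"

lemma push_nat [simp]:
  "push \<in> Arr (functor_cat X D)" "NDom push = Fn G \<cdot> \<Sigma> \<cdot> M" "NCod push = Fn C \<cdot> \<Sigma> \<cdot> M"
  by (simp_all add: push_coalgebra_def)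

lemma push_at:
  "x \<in> Ob X \<Longrightarrow> NAt push x =
    Comp D (NAt \<gamma> (FOb M x)) (Comp D (FArr \<Sigma> (NAt \<rho> x)) (NAt \<sigma> (FOb M x)))"
  by (simp add: push_coalgebra_def)

lemmas push_simps [simp] = nat_simps[OF push_nat(1)]

lemma push_\<epsilon>:
  assumes "x \<in> Ob X"
  shows "Comp D (NAt (\<epsilon> C) (FOb \<Sigma> (FOb M x))) (NAt push x) = NAt (\<epsilon> G) (FOb \<Sigma> (FOb M x))"
  using assms Comp_tail[OF functor_Comp_eq[OF srcM.\<rho>_\<epsilon> \<Sigma>\<sigma>.\<Sigma>_functor]]
  by (simp add: push_at Comp_tail[OF \<Sigma>\<gamma>.\<gamma>_\<epsilon>] \<Sigma>\<sigma>.\<sigma>_\<epsilon>)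

text \<open>The comultiplication splits \<open>\<gamma>\<close>, \<open>\<rho>\<close> and \<open>\<sigma>\<close> in turn, each by its own axiom. The \<open>\<chi>\<close> produced by \<open>\<rho>\<close> then
stands between the inner copies of \<open>\<gamma>\<close> and \<open>\<sigma>\<close>, where the hexagon replaces it by the \<open>\<tau>\<close> that is wanted.\<close>

lemma push_\<delta>:
  assumes "x \<in> Ob X"
  shows "Comp D (NAt (\<delta> C) (FOb \<Sigma> (FOb M x))) (NAt push x) = Comp D (FArr (Fn C) (NAt push x))
    (Comp D (NAt \<tau> (FOb \<Sigma> (FOb M x))) (Comp D (FArr (Fn G) (NAt push x)) (NAt (\<delta> G) (FOb \<Sigma> (FOb M x)))))"
  using assms Comp_tail[OF functor_Comp_eq[OF srcM.\<rho>_\<delta> \<Sigma>\<sigma>.\<Sigma>_functor]]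
    Comp_tail[OF \<Sigma>\<sigma>.\<sigma>_natural[symmetric, of "NAt \<rho> x"]]
    Comp_tail[OF \<Sigma>\<gamma>.\<gamma>_natural[of "NAt \<rho> x"]]
  by (simp add: push_at Comp_tail[OF \<Sigma>\<gamma>.\<gamma>_\<delta>] \<Sigma>\<sigma>.\<sigma>_\<delta> Comp_tail3[OF hexagon])

lemma push_coalgebra_str: "coalgebra_str \<tau> G C (\<Sigma> \<cdot> M) push"
  unfolding coalgebra_str_def
proof (intro conjI)
  show "is_nat push (Fn G \<cdot> \<Sigma> \<cdot> M) (Fn C \<cdot> \<Sigma> \<cdot> M)"
    using push_nat(1) by (simp add: in_Arr_functor_cat)
  show "(\<delta> C \<lhd> (\<Sigma> \<cdot> M)) \<odot> push =
      (Fn C \<rhd> push) \<odot> (\<tau> \<lhd> (\<Sigma> \<cdot> M)) \<odot> (Fn G \<rhd> push) \<odot> (\<delta> G \<lhd> (\<Sigma> \<cdot> M))"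
    by (rule nat_eqI[of _ X D]) (simp_all add: push_\<delta>)
  show "(\<epsilon> C \<lhd> (\<Sigma> \<cdot> M)) \<odot> push = \<epsilon> G \<lhd> (\<Sigma> \<cdot> M)"
    by (rule nat_eqI[of _ X D]) (simp_all add: push_\<epsilon>)
qed

sublocale tgtM: coalgebra D G C \<tau> X "\<Sigma> \<cdot> M" push
  by unfold_locales (simp_all add: push_coalgebra_str)

text \<open>Here \<open>\<sigma>\<^sup>n\<close> turns the arrow attached to \<open>\<Sigma>M\<close> into the one attached to \<open>M\<close>: the iterated hexagon replaces \<open>\<tau>\<^sup>n\<close> by
\<open>\<chi>\<^sup>n\<close>, which uses up \<open>G\<^sup>n\<gamma>\<close> from the structure of \<open>\<Sigma>M\<close>, while \<open>G\<^sup>n\<sigma>\<close> completes \<open>\<sigma>\<^sup>n\<close> to \<open>\<sigma>\<^sup>n\<^sup>+\<^sup>1\<close>.\<close>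

lemma coalg_T_push:
  assumes "x \<in> Ob X"
  shows "Comp D (FArr (Fn C) (NAt (\<Sigma>\<sigma>.iter n) (FOb M x))) (tgtM.coalg_T n x) =
    Comp D (NAt \<gamma> (FOb (Fn T \<up> n) (FOb M x)))
      (Comp D (FArr \<Sigma> (srcM.coalg_T n x)) (NAt (\<Sigma>\<sigma>.iter (Suc n)) (FOb M x)))"
  using assms Comp_tail[OF \<Sigma>\<sigma>.iter_natural[symmetric, of "NAt \<rho> x"]]
  by (simp add: tgtM.coalg_T_def srcM.coalg_T_def push_at \<Sigma>\<sigma>.iter_Suc' Comp_tail3[OF hexagon_\<sigma>_iter])

lemma coalg_S_push:
  assumes "x \<in> Ob X"
  shows "Comp D (tgtM.coalg_S n x) (FArr (Fn G) (NAt (\<Sigma>\<gamma>.iter n) (FOb M x))) =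
    Comp D (NAt (\<Sigma>\<gamma>.iter (Suc n)) (FOb M x))
      (Comp D (FArr \<Sigma> (srcM.coalg_S n x)) (NAt \<sigma> (FOb (Fn S \<up> n) (FOb M x))))"
  using assms Comp_tail[OF \<Sigma>\<gamma>.iter_natural[of "NAt \<rho> x"]]
  by (simp add: tgtM.coalg_S_def srcM.coalg_S_def push_at \<Sigma>\<gamma>.iter_Suc' hexagon_\<gamma>_iter[symmetric])

end

locale opcoalgebra_1cell = one_cell B T S \<chi> D G C \<tau> \<Sigma> \<sigma> \<gamma> + tgtN: opcoalgebra D G C \<tau> Y N l
  for B :: "('o, 'm) cat" and T S \<chi> and D :: "('p, 'n) cat" and G C \<tau> \<Sigma> \<sigma> \<gamma>
    and Y :: "('q, 'k) cat" and N l
begin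

abbreviation pull where "pull \<equiv> pull_opcoalgebra \<Sigma> \<sigma> \<gamma> N l"

lemma pull_nat [simp]:
  "pull \<in> Arr (functor_cat B Y)" "NDom pull = N \<cdot> \<Sigma> \<cdot> Fn S" "NCod pull = N \<cdot> \<Sigma> \<cdot> Fn T"
  by (simp_all add: pull_opcoalgebra_def)

lemma pull_at:
  "x \<in> Ob B \<Longrightarrow> NAt pull x =
    Comp Y (FArr N (NAt \<sigma> x)) (Comp Y (NAt l (FOb \<Sigma> x)) (FArr N (NAt \<gamma> x)))"
  by (simp add: pull_opcoalgebra_def)

lemmas pull_simps [simp] = nat_simps[OF pull_nat(1)]

lemma pull_\<epsilon>:
  assumes "x \<in> Ob B"
  shows "Comp Y (FArr N (FArr \<Sigma> (NAt (\<epsilon> T) x))) (NAt pull x) = FArr N (FArr \<Sigma> (NAt (\<epsilon> S) x))"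
  using assms Comp_tail[OF functor_Comp_eq[OF \<Sigma>\<sigma>.\<sigma>_\<epsilon> tgtN.N_functor]]
    functor_Comp_eq[OF \<Sigma>\<gamma>.\<gamma>_\<epsilon> tgtN.N_functor]
  by (simp add: pull_at Comp_tail[OF tgtN.l_\<epsilon>])

lemma pull_\<delta>:
  assumes "x \<in> Ob B"
  shows "Comp Y (FArr N (FArr \<Sigma> (NAt (\<delta> T) x))) (NAt pull x) = Comp Y (NAt pull (FOb (Fn T) x))
    (Comp Y (FArr N (FArr \<Sigma> (NAt \<chi> x))) (Comp Y (NAt pull (FOb (Fn S) x))
      (FArr N (FArr \<Sigma> (NAt (\<delta> S) x)))))"
proof -
  have "Comp Y (FArr N (NAt \<gamma> (FOb (Fn T) x))) (Comp Y (FArr N (FArr \<Sigma> (NAt \<chi> x)))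
      (FArr N (NAt \<sigma> (FOb (Fn S) x)))) =
    Comp Y (FArr N (FArr (Fn C) (NAt \<sigma> x))) (Comp Y (FArr N (NAt \<tau> (FOb \<Sigma> x)))
      (FArr N (FArr (Fn G) (NAt \<gamma> x))))"
    using assms arg_cong[OF hexagon[OF assms], of "FArr N"] by simp
  from assms Comp_tail3[OF this] Comp_tail[OF functor_Comp_eq[OF \<Sigma>\<sigma>.\<sigma>_\<delta> tgtN.N_functor]]
    functor_Comp_eq[OF \<Sigma>\<gamma>.\<gamma>_\<delta> tgtN.N_functor]
    Comp_tail[OF tgtN.l_natural[symmetric, of "NAt \<sigma> x"]] Comp_tail[OF tgtN.l_natural[of "NAt \<gamma> x"]]
  show ?thesis
    by (simp add: pull_at Comp_tail[OF tgtN.l_\<delta>])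
qed

lemma pull_opcoalgebra_str: "opcoalgebra_str \<chi> T S (N \<cdot> \<Sigma>) pull"
  unfolding opcoalgebra_str_def
proof (intro conjI)
  show "is_nat pull ((N \<cdot> \<Sigma>) \<cdot> Fn S) ((N \<cdot> \<Sigma>) \<cdot> Fn T)"
    using pull_nat(1) by (simp add: in_Arr_functor_cat)
  show "((N \<cdot> \<Sigma>) \<rhd> \<delta> T) \<odot> pull =
      (pull \<lhd> Fn T) \<odot> ((N \<cdot> \<Sigma>) \<rhd> \<chi>) \<odot> (pull \<lhd> Fn S) \<odot> ((N \<cdot> \<Sigma>) \<rhd> \<delta> S)"
    by (rule nat_eqI[of _ B Y]) (simp_all add: pull_\<delta>)
  show "((N \<cdot> \<Sigma>) \<rhd> \<epsilon> T) \<odot> pull = (N \<cdot> \<Sigma>) \<rhd> \<epsilon> S"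
    by (rule nat_eqI[of _ B Y]) (simp_all add: pull_\<epsilon>)
qed

sublocale srcN: opcoalgebra B T S \<chi> Y "N \<cdot> \<Sigma>" pull
  by unfold_locales (simp_all add: pull_opcoalgebra_str)

end

locale coalgebra_pair_1cell =
  coalgebra_1cell B T S \<chi> D G C \<tau> \<Sigma> \<sigma> \<gamma> X M \<rho> + opcoalgebra_1cell B T S \<chi> D G C \<tau> \<Sigma> \<sigma> \<gamma> Y N l
  for B :: "('o, 'm) cat" and T S \<chi> and D :: "('p, 'n) cat" and G C \<tau> \<Sigma> \<sigma> \<gamma>
    and X :: "('q, 'k) cat" and M \<rho> and Y :: "('r, 'j) cat" and N l
begin

sublocale src_pair: coalgebra_pair B T S \<chi> X M \<rho> Y "N \<cdot> \<Sigma>" pull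
  by unfold_locales

sublocale tgt_pair: coalgebra_pair D G C \<tau> X "\<Sigma> \<cdot> M" push Y N l
  by unfold_locales

text \<open>For the operators, the outermost factor of \<open>\<sigma>\<^sup>n\<^sup>+\<^sup>1\<close> stays in front as part of the pulled back structure on \<open>N\<Sigma>\<close>, and
the remaining \<open>\<sigma>\<^sup>n\<close> moves past \<open>l\<close> by naturality, ready for \<open>coalg_T_push\<close>.\<close>

lemma \<sigma>_duplicial_morphism:
  "duplicial_morphism (functor_cat X Y)
     (bar_dup \<tau> G C N l (\<Sigma> \<cdot> M) push) (bar_dup \<chi> T S (N \<cdot> \<Sigma>) pull M \<rho>)
     (\<lambda>n. N \<rhd> \<Sigma>\<sigma>.iter (n + 1) \<lhd> M)"
proof (rule duplicial_morphism_pointwise[OF tgt_pair.duplicial_bar src_pair.duplicial_bar], goal_cases)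
  case (1 n)
  show ?case by (simp add: bar_dup_def functor_cat_arrow)
next
  case (2 n i x)
  with arg_cong[OF \<Sigma>\<sigma>.iter_face[of "FOb M x" i "Suc n"], of "FArr N"] show ?case
    by (simp add: src_pair.bar_dup_at tgt_pair.bar_dup_at)
next
  case (3 n j x)
  with arg_cong[OF \<Sigma>\<sigma>.iter_degen[of "FOb M x" j n], of "FArr N"] show ?case
    by (simp add: src_pair.bar_dup_at tgt_pair.bar_dup_at)
next
  case (4 n x)
  with functor_Comp_eq[OF coalg_T_push[of x n] tgtN.N_functor]
    Comp_tail[OF tgtN.l_natural[symmetric, of "NAt (\<Sigma>\<sigma>.iter n) (FOb M x)"]]
  show ?case
    by (simp add: src_pair.bar_dup_at tgt_pair.bar_dup_at pull_at \<Sigma>\<sigma>.iter_Suc)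
qed

lemma \<gamma>_duplicial_morphism:
  "duplicial_morphism (functor_cat X Y)
     (bar_op_dup \<chi> T S (N \<cdot> \<Sigma>) pull M \<rho>) (bar_op_dup \<tau> G C N l (\<Sigma> \<cdot> M) push)
     (\<lambda>n. N \<rhd> \<Sigma>\<gamma>.iter (n + 1) \<lhd> M)"
proof (rule duplicial_morphism_pointwise[OF src_pair.duplicial_bar_op tgt_pair.duplicial_bar_op],
    goal_cases)
  case (1 n)
  show ?case by (simp add: bar_op_dup_def functor_cat_arrow)
next
  case (2 n i x)
  with arg_cong[OF \<Sigma>\<gamma>.iter_face[of "FOb M x" "Suc n - i" "Suc n"], of "FArr N"] show ?case
    by (simp add: src_pair.bar_op_dup_at tgt_pair.bar_op_dup_at)
next
  case (3 n j x)
  with arg_cong[OF \<Sigma>\<gamma>.iter_degen[of "FOb M x" "n - j" n], of "FArr N"] show ?case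
    by (simp add: src_pair.bar_op_dup_at tgt_pair.bar_op_dup_at)
next
  case (4 n x)
  with Comp_tail[OF functor_Comp_eq[OF coalg_S_push[of x n] tgtN.N_functor]]
    Comp_tail[OF tgtN.l_natural[of "NAt (\<Sigma>\<gamma>.iter n) (FOb M x)"]]
  show ?case
    by (simp add: src_pair.bar_op_dup_at tgt_pair.bar_op_dup_at pull_at \<Sigma>\<gamma>.iter_Suc)
qed

end

theorem proposition4p3p14:
  fixes B :: "('ob, 'mb) cat" and D :: "('od, 'md) cat"
    and X :: "('ox, 'mx) cat" and Y :: "('oy, 'my) cat"
    and T S :: "('ob, 'mb) comonad" and \<chi> :: "('ob, 'mb, 'ob, 'mb) ntrans"
    and G C :: "('od, 'md) comonad" and \<tau> :: "('od, 'md, 'od, 'md) ntrans"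
    and \<Sigma> :: "('ob, 'mb, 'od, 'md) ftor" and \<sigma> \<gamma> :: "('ob, 'mb, 'od, 'md) ntrans"
    and M :: "('ox, 'mx, 'ob, 'mb) ftor" and \<rho> :: "('ox, 'mx, 'ob, 'mb) ntrans"
    and N :: "('od, 'md, 'oy, 'my) ftor" and l :: "('od, 'md, 'oy, 'my) ntrans"
  assumes "dist_1cell B \<chi> T S D \<tau> G C \<Sigma> \<sigma> \<gamma>"
    and "is_functor M X B" and "coalgebra_str \<chi> T S M \<rho>"
    and "is_functor N D Y" and "opcoalgebra_str \<tau> G C N l"
  shows "duplicial_morphism (functor_cat X Y)
           (bar_dup \<tau> G C N l (\<Sigma> \<cdot> M) (push_coalgebra \<Sigma> \<sigma> \<gamma> M \<rho>))
           (bar_dup \<chi> T S (N \<cdot> \<Sigma>) (pull_opcoalgebra \<Sigma> \<sigma> \<gamma> N l) M \<rho>)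
           (\<lambda>n. N \<rhd> iter_l (Fn G) \<Sigma> (Fn T) \<sigma> (n + 1) \<lhd> M)
       \<and> duplicial_morphism (functor_cat X Y)
           (bar_op_dup \<chi> T S (N \<cdot> \<Sigma>) (pull_opcoalgebra \<Sigma> \<sigma> \<gamma> N l) M \<rho>)
           (bar_op_dup \<tau> G C N l (\<Sigma> \<cdot> M) (push_coalgebra \<Sigma> \<sigma> \<gamma> M \<rho>))
           (\<lambda>n. N \<rhd> iter_r (Fn S) \<Sigma> (Fn C) \<gamma> (n + 1) \<lhd> M)"
proof -
  have "dist_law B \<chi> T S" "dist_law D \<tau> G C"
    using assms(1) by (simp_all add: dist_1cell_def)
  moreover from this have "is_comonad B T" "is_comonad B S" "is_comonad D G" "is_comonad D C"
    by (simp_all add: dist_law_def)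
  ultimately interpret coalgebra_pair_1cell B T S \<chi> D G C \<tau> \<Sigma> \<sigma> \<gamma> X M \<rho> Y N l
    using assms by unfold_locales
  show ?thesis
    using \<sigma>_duplicial_morphism \<gamma>_duplicial_morphism by (rule conjI)
qed

end
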